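(* Let $\alpha,\beta>-1$ with $|\beta|\geq 1/2$, and let $\theta_{j,k}^{(\alpha,\beta)}$ ($j\ge 1$, $1\le k\le j$) denote the angular zeros of the Jacobi polynomials, i.e. $0<\theta_{j,1}^{(\alpha,\beta)}<\cdots<\theta_{j,j}^{(\alpha,\beta)}<\pi$ and $P_j^{(\alpha,\beta)}(\cos\theta_{j,k}^{(\alpha,\beta)})=0$. Set $\rho=\frac{\alpha+\beta+1}{2}$, \[ \Phi_{\alpha,\beta}(x)=\frac{1-4\alpha^2}{16}\,\frac{1-x\cot x}{\sin^2x}+\frac{1-4\beta^2}{16}\,\frac{1+x\tan x}{\cos^2x},\qquad 0<x<\frac{\pi}{2}, \] and \[ M_{\alpha,\beta}=\sup_{0<x<\pi/2}\Phi_{\alpha,\beta}(x). \] Then $M_{\alpha,\beta}$ is finite. Define \[ \sigma_\downarrow(\alpha,\beta)=\rho+\frac{(M_{\alpha,\beta})_+}{1+\rho}, \] where $s_+=\max\{s,0\}$. If $\sigma\geq\sigma_\downarrow(\alpha,\beta)$, then \[ (n+1+\sigma)\,\theta_{n+1,k}^{(\alpha,\beta)}\leq(n+\sigma)\,\theta_{n,k}^{(\alpha,\beta)} \] for every integer $n\geq1$ and $1\leq k\leq n$. Equality holds for some such $n$ and $k$ if and only if $|\alpha|=|\beta|=\frac12$ and $\sigma=\rho$. In that case, equality holds for every integer $n\geq1$ and $1\leq k\leq n$.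
   Context: $P_n^{(\alpha,\beta)}$ denotes the Jacobi polynomial of degree $n$ (orthogonal on $(-1,1)$ with respect to the weight $(1-x)^\alpha(1+x)^\beta$), normalised by $P_n^{(\alpha,\beta)}(1)=(\alpha+1)_n/n!$. For $\alpha,\beta>-1$ its $n$ zeros are simple and lie in $(-1,1)$, so the angles $\theta_{n,k}^{(\alpha,\beta)}$ are well defined. *)

theory Defs
  imports "HOL-Analysis.Analysis" "HOL-Computational_Algebra.Polynomial"
begin

definition is_jacobi_poly :: "real \<Rightarrow> real \<Rightarrow> nat \<Rightarrow> real poly \<Rightarrow> bool" where
  "is_jacobi_poly \<alpha> \<beta> n p \<longleftrightarrow>
     degree p = n \<and>
     (\<forall>q. degree q < n \<longrightarrow>
        (LBINT x:{-1<..<1}. poly p x * poly q x * ((1 - x) powr \<alpha> * (1 + x) powr \<beta>)) = 0) \<and>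
     poly p 1 = pochhammer (\<alpha> + 1) n / fact n"

definition jacobi_poly :: "real \<Rightarrow> real \<Rightarrow> nat \<Rightarrow> real poly" where
  "jacobi_poly \<alpha> \<beta> n = (THE p. is_jacobi_poly \<alpha> \<beta> n p)"

text \<open>The angles of the zeros in increasing order; they are numbered from 1, list
  positions from 0.\<close>

definition jacobi_angle :: "real \<Rightarrow> real \<Rightarrow> nat \<Rightarrow> nat \<Rightarrow> real" where
  "jacobi_angle \<alpha> \<beta> n k =
     sorted_list_of_set {t. 0 < t \<and> t < pi \<and> poly (jacobi_poly \<alpha> \<beta> n) (cos t) = 0} ! (k - 1)"

definition jacobi_rho :: "real \<Rightarrow> real \<Rightarrow> real" where
  "jacobi_rho \<alpha> \<beta> = (\<alpha> + \<beta> + 1) / 2"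

definition jacobi_Phi :: "real \<Rightarrow> real \<Rightarrow> real \<Rightarrow> real" where
  "jacobi_Phi \<alpha> \<beta> x =
     (1 - 4 * \<alpha>\<^sup>2) / 16 * ((1 - x * cot x) / (sin x)\<^sup>2) +
     (1 - 4 * \<beta>\<^sup>2) / 16 * ((1 + x * tan x) / (cos x)\<^sup>2)"

text \<open>The supremum is taken in the reals, so it is meaningful only when the range is
  bounded above.\<close>

definition jacobi_M :: "real \<Rightarrow> real \<Rightarrow> real" where
  "jacobi_M \<alpha> \<beta> = (SUP x\<in>{0<..<pi/2}. jacobi_Phi \<alpha> \<beta> x)"

definition sigma_down :: "real \<Rightarrow> real \<Rightarrow> real" where
  "sigma_down \<alpha> \<beta> =
     jacobi_rho \<alpha> \<beta> + max (jacobi_M \<alpha> \<beta>) 0 / (1 + jacobi_rho \<alpha> \<beta>)"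

end

theory Submission
  imports Defs
begin

text \<open>The proof is a Sturm comparison between consecutive degrees, made after a rescaling that turns the
claim into a comparison of zeros of two second-order equations on a common interval.

Put \<open>U(x) = (sin x)\<^bsup>\<alpha> + 1/2\<^esup> (cos x)\<^bsup>\<beta> + 1/2\<^esup> P\<^sub>n(cos 2x)\<close>. The Jacobi equation becomes
\<open>U'' + R U = 0\<close> with \<open>R(x) = 4 (n + \<rho>)\<^sup>2 + (1/4 - \<alpha>\<^sup>2) / sin\<^sup>2 x + (1/4 - \<beta>\<^sup>2) / cos\<^sup>2 x\<close>. For \<open>\<nu> = n + \<sigma>\<close> the
function \<open>V(s) = U(s/\<nu>)\<close> has the zeros \<open>\<nu> \<theta>\<^sub>n\<^sub>,\<^sub>k / 2\<close> and satisfies \<open>V'' + q V = 0\<close> with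
\<open>q = R(s/\<nu>) / \<nu>\<^sup>2\<close>. Written with \<open>\<tau> = \<sigma> - \<rho>\<close>, this \<open>q\<close> depends on the degree only through \<open>\<nu>\<close>, and
\<open>\<partial>q/\<partial>\<nu> = 8 \<nu>\<^bsup>-3\<^esup> (\<tau> (\<nu> - \<tau>) - \<Phi>(s/\<nu>))\<close> (\<open>DERIV_scaled_potential\<close>). Between degrees \<open>n\<close> and \<open>n + 1\<close>
one has \<open>\<nu> - \<tau> \<ge> 1 + \<rho>\<close>, so \<open>\<tau> (1 + \<rho>) \<ge> M\<^sub>+\<close> suffices for \<open>q\<close> to increase with the degree; this is the
assumption on \<open>\<sigma>\<close>. A larger \<open>q\<close> moves each zero to the left, which is the claimed inequality.

The comparison starts at the singular endpoint 0. Both solutions have the same exponent there, and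
their Wronskian tends to 0 for every \<open>\<alpha> > -1\<close> (\<open>liouville_wronskian_tendsto\<close>), which is what Sturm's argument
needs at an endpoint that is not a zero (\<open>sturm_comparison\<close>).

The inequality is strict except when \<open>q\<close> does not depend on \<open>\<nu>\<close>. For \<open>\<tau> > 0\<close> the derivative of \<open>q\<close> is
positive as soon as \<open>\<nu> - \<tau> > 1 + \<rho>\<close>. For \<open>\<tau> = 0\<close> necessarily \<open>M \<le> 0\<close>, and then \<open>\<Phi>\<close> is negative
everywhere unless \<open>|\<alpha>| = |\<beta>| = 1/2\<close> (\<open>jacobi_Phi_neg\<close>). In the exceptional case the two solutions are
proportional, so they have the same zeros on the smaller interval (\<open>scaled_zeros_half\<close>).

These facts are about solutions of a differential equation, whereas the Jacobi polynomial is given by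
orthogonality. The hypergeometric polynomial solves the equation and is orthogonal by Green's
formula; a positive definite inner product admits only one such polynomial
(\<open>jacobi_poly_eq\<close>). Its zeros are counted by a second use of Sturm comparison, in the variable \<open>x\<close>, by
induction on the degree (\<open>card_jacobi_roots\<close>).\<close>

section \<open>The Jacobi equation and its polynomial solution\<close>

definition jacobi_weight :: "real \<Rightarrow> real \<Rightarrow> real \<Rightarrow> real" where
  "jacobi_weight \<alpha> \<beta> x = (1 - x) powr \<alpha> * (1 + x) powr \<beta>"

definition jacobi_op :: "real \<Rightarrow> real \<Rightarrow> real poly \<Rightarrow> real poly" where
  "jacobi_op \<alpha> \<beta> q =
     [:1, 0, -1:] * pderiv (pderiv q) + [:\<beta> - \<alpha>, - (\<alpha> + \<beta> + 2):] * pderiv q"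

definition jacobi_eig :: "real \<Rightarrow> real \<Rightarrow> nat \<Rightarrow> real" where
  "jacobi_eig \<alpha> \<beta> n = real n * (real n + \<alpha> + \<beta> + 1)"

lemma jacobi_eig_less:
  assumes "\<alpha> > -1" "\<beta> > -1" "m < n"
  shows "jacobi_eig \<alpha> \<beta> m < jacobi_eig \<alpha> \<beta> n"
proof -
  have "jacobi_eig \<alpha> \<beta> n - jacobi_eig \<alpha> \<beta> m
      = (real n - real m) * (real n + real m + \<alpha> + \<beta> + 1)"
    by (simp add: jacobi_eig_def algebra_simps)
  moreover have "(real n - real m) * (real n + real m + \<alpha> + \<beta> + 1) > 0"
    using assms by (intro mult_pos_pos) linarith+
  ultimately show ?thesis by linarith
qed

text \<open>The operator maps a polynomial of degree \<open>m\<close> to one of degree at most \<open>m\<close>, and on the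
leading coefficient it acts as multiplication by minus the eigenvalue of index \<open>m\<close>.\<close>

lemma coeff_jacobi_op:
  "coeff (jacobi_op \<alpha> \<beta> q) i =
     (real i + 2) * (real i + 1) * coeff q (i + 2) +
     (\<beta> - \<alpha>) * (real i + 1) * coeff q (i + 1) - jacobi_eig \<alpha> \<beta> i * coeff q i"
proof -
  consider "i = 0" | "i = 1" | j where "i = Suc (Suc j)"
    by (metis One_nat_def not0_implies_Suc)
  then show ?thesis
    by cases (simp_all add: jacobi_op_def jacobi_eig_def coeff_pderiv coeff_pCons
        algebra_simps numeral_2_eq_2)
qed

text \<open>The terminating Gauss series \<open>\<^sub>2F\<^sub>1(-n, n + \<alpha> + \<beta> + 1; \<alpha> + 1; z)\<close>. With \<open>z = (1 - x) / 2\<close>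
it is the Jacobi polynomial up to normalisation, and the point \<open>x = 1\<close> where the normalisation is
prescribed becomes \<open>z = 0\<close>.\<close>

definition jacobi_hyp :: "real \<Rightarrow> real \<Rightarrow> nat \<Rightarrow> real poly" where
  "jacobi_hyp \<alpha> \<beta> n = (\<Sum>k\<le>n. monom
     (pochhammer (- real n) k * pochhammer (real n + \<alpha> + \<beta> + 1) k /
       (pochhammer (\<alpha> + 1) k * fact k)) k)"

text \<open>The formula holds beyond the range of summation because the Pochhammer symbol of \<open>-n\<close> vanishes
there, so the recursion below needs no boundary case.\<close>

lemma coeff_jacobi_hyp:
  "coeff (jacobi_hyp \<alpha> \<beta> n) k =
     pochhammer (- real n) k * pochhammer (real n + \<alpha> + \<beta> + 1) k /
       (pochhammer (\<alpha> + 1) k * fact k)"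
proof (cases "k \<le> n")
  case True
  then show ?thesis by (simp add: jacobi_hyp_def coeff_sum)
next
  case False
  then have "pochhammer (- real n) k = 0"
    by (simp add: pochhammer_of_nat_eq_0_iff)
  then show ?thesis using False by (simp add: jacobi_hyp_def coeff_sum)
qed

lemma coeff_jacobi_hyp_Suc:
  assumes "\<alpha> > -1"
  shows "(real k + 1) * (real k + \<alpha> + 1) * coeff (jacobi_hyp \<alpha> \<beta> n) (Suc k) =
    (real k - real n) * (real n + real k + \<alpha> + \<beta> + 1) * coeff (jacobi_hyp \<alpha> \<beta> n) k"
proof -
  have pos: "real k + \<alpha> + 1 > 0"
    using assms by auto
  have frac: "b * a * (P * x * (Q * y) / (A * a' * (b' * F))) = x' * y' * (P * Q / (A * F))"
    if "a \<noteq> 0" "b \<noteq> 0" "a' = a" "b' = b" "x' = x" "y' = y"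
    for a b x y P Q A F a' b' x' y' :: real
    using that by (simp add: field_simps)
  show ?thesis
    unfolding coeff_jacobi_hyp pochhammer_Suc fact_Suc
    by (rule frac) (use pos in auto)
qed

lemma jacobi_hyp_ode:
  fixes \<alpha> \<beta> :: real and n :: nat
  assumes "\<alpha> > -1"
  defines "h \<equiv> jacobi_hyp \<alpha> \<beta> n"
  shows "[:0, 1, -1:] * pderiv (pderiv h) + [:\<alpha> + 1, - (\<alpha> + \<beta> + 2):] * pderiv h
    + smult (jacobi_eig \<alpha> \<beta> n) h = 0"
proof (rule poly_eqI)
  fix i
  have *: "(real i + 1) * (real i + \<alpha> + 1) * coeff h (Suc i) =
    (real i - real n) * (real n + real i + \<alpha> + \<beta> + 1) * coeff h i"
    unfolding h_def by (rule coeff_jacobi_hyp_Suc[OF assms(1)])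
  consider "i = 0" | "i = 1" | j where "i = Suc (Suc j)"
    by (metis One_nat_def not0_implies_Suc)
  then show "coeff ([:0, 1, -1:] * pderiv (pderiv h) +
      [:\<alpha> + 1, - (\<alpha> + \<beta> + 2):] * pderiv h + smult (jacobi_eig \<alpha> \<beta> n) h) i = coeff 0 i"
    using *
    by cases (simp_all add: jacobi_eig_def coeff_pderiv coeff_pCons
        algebra_simps numeral_2_eq_2)
qed

definition jacobi_sol :: "real \<Rightarrow> real \<Rightarrow> nat \<Rightarrow> real poly" where
  "jacobi_sol \<alpha> \<beta> n =
     smult (pochhammer (\<alpha> + 1) n / fact n) (jacobi_hyp \<alpha> \<beta> n \<circ>\<^sub>p [:1/2, -1/2:])"

lemma jacobi_sol_at_1: "poly (jacobi_sol \<alpha> \<beta> n) 1 = pochhammer (\<alpha> + 1) n / fact n"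
  by (simp add: jacobi_sol_def poly_pcompose coeff_jacobi_hyp poly_0_coeff_0)

text \<open>The leading coefficient contains the factors \<open>n + \<alpha> + \<beta> + 1 + i\<close> with \<open>i < n\<close>. They are positive
although \<open>\<alpha> + \<beta> + 1\<close> can be negative: they occur only for \<open>n \<ge> 1\<close>, and \<open>\<alpha> + \<beta> > -2\<close>.\<close>

lemma degree_jacobi_sol:
  assumes "\<alpha> > -1" "\<beta> > -1"
  shows "degree (jacobi_sol \<alpha> \<beta> n) = n"
proof -
  have p1: "pochhammer (\<alpha> + 1) n > 0"
    using assms by (auto intro: pochhammer_pos)
  have p2: "pochhammer (real n + \<alpha> + \<beta> + 1) n \<noteq> 0"
  proof (cases "n = 0")
    case False
    then have "real n + \<alpha> + \<beta> + 1 > 0" using assms by linarith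
    then show ?thesis using pochhammer_pos[of "real n + \<alpha> + \<beta> + 1" n] by linarith
  qed auto
  have p3: "pochhammer (- real n) n \<noteq> 0"
    by (simp add: pochhammer_of_nat_eq_0_iff)
  have "coeff (jacobi_hyp \<alpha> \<beta> n) n \<noteq> 0"
    unfolding coeff_jacobi_hyp using p1 p2 p3 by simp
  moreover have "degree (jacobi_hyp \<alpha> \<beta> n) \<le> n"
    unfolding jacobi_hyp_def
    by (intro degree_sum_le) (auto intro: order.trans[OF degree_monom_le])
  ultimately have "degree (jacobi_hyp \<alpha> \<beta> n) = n"
    using le_degree by (intro antisym) blast+
  then show ?thesis using p1 by (simp add: jacobi_sol_def degree_pcompose)
qed

lemma jacobi_sol_ode:
  assumes "\<alpha> > -1"
  shows "jacobi_op \<alpha> \<beta> (jacobi_sol \<alpha> \<beta> n)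
    = smult (- jacobi_eig \<alpha> \<beta> n) (jacobi_sol \<alpha> \<beta> n)"
proof -
  define h where "h = jacobi_hyp \<alpha> \<beta> n"
  define g where "g = h \<circ>\<^sub>p [:1/2, -1/2:]"
  have d1: "pderiv g = smult (-1/2) (pderiv h \<circ>\<^sub>p [:1/2, -1/2:])"
    unfolding g_def pderiv_pcompose by (simp add: pderiv_pCons)
  have d2: "pderiv (pderiv g) = smult (1/4) (pderiv (pderiv h) \<circ>\<^sub>p [:1/2, -1/2:])"
    unfolding d1 pderiv_smult pderiv_pcompose by (simp add: pderiv_pCons)
  have "jacobi_op \<alpha> \<beta> g = smult (- jacobi_eig \<alpha> \<beta> n) g"
  proof (subst poly_eq_poly_eq_iff[symmetric], rule ext)
    fix x :: real
    define z where "z = 1/2 - x/2"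
    have x: "x = 1 - 2*z" by (simp add: z_def)
    have "poly ([:0, 1, -1:] * pderiv (pderiv h) + [:\<alpha> + 1, - (\<alpha> + \<beta> + 2):] * pderiv h
      + smult (jacobi_eig \<alpha> \<beta> n) h) z = 0"
      using jacobi_hyp_ode[OF assms, of \<beta> n] unfolding h_def by simp
    then show "poly (jacobi_op \<alpha> \<beta> g) x = poly (smult (- jacobi_eig \<alpha> \<beta> n) g) x"
      unfolding jacobi_op_def d2 unfolding d1 unfolding g_def
      by (simp add: poly_pcompose z_def[symmetric]) (simp add: x field_simps)
  qed
  moreover have "jacobi_op \<alpha> \<beta> (smult c g) = smult c (jacobi_op \<alpha> \<beta> g)" for c
    by (simp add: jacobi_op_def pderiv_smult smult_add_right)
  ultimately show ?thesis
    unfolding jacobi_sol_def h_def[symmetric] g_def[symmetric] by (simp add: mult.commute)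
qed

text \<open>The operator in self-adjoint form. Raising both exponents of the weight by one makes the flux vanish
at \<open>-1\<close> and \<open>1\<close>, which disposes of the boundary terms in Green's formula and of the
boundary values of Wronskians.\<close>

lemma DERIV_jacobi_flux:
  assumes "-1 < x" "x < 1"
  shows "((\<lambda>x. jacobi_weight (\<alpha> + 1) (\<beta> + 1) x * poly (pderiv f) x) has_real_derivative
    jacobi_weight \<alpha> \<beta> x * poly (jacobi_op \<alpha> \<beta> f) x) (at x)"
proof -
  have pos: "1 - x > 0" "1 + x > 0" using assms by auto
  have 1: "((\<lambda>x. (1 - x) powr (\<alpha> + 1)) has_real_derivative - (\<alpha> + 1) * (1 - x) powr \<alpha>) (at x)"
    using pos by (auto intro!: derivative_eq_intros simp: algebra_simps)
  have 2: "((\<lambda>x. (1 + x) powr (\<beta> + 1)) has_real_derivative (\<beta> + 1) * (1 + x) powr \<beta>) (at x)"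
    using pos by (auto intro!: derivative_eq_intros)
  have 3: "(1 - x) powr (\<alpha> + 1) = (1 - x) * (1 - x) powr \<alpha>"
    "(1 + x) powr (\<beta> + 1) = (1 + x) * (1 + x) powr \<beta>"
    using pos by (simp_all add: powr_add)
  show ?thesis
    unfolding jacobi_weight_def jacobi_op_def
    by (rule DERIV_cong[OF DERIV_mult[OF DERIV_mult[OF 1 2] poly_DERIV]])
       (simp add: 3, simp add: algebra_simps)
qed

section \<open>Orthogonality and uniqueness\<close>

lemma tendsto_powr_0_at:
  fixes c :: real
  assumes "c > 0" "(f \<longlongrightarrow> (0::real)) F" "\<forall>\<^sub>F x in F. f x \<ge> 0"
  shows "((\<lambda>x. f x powr c) \<longlongrightarrow> 0) F"
  using tendsto_powr2[OF assms(2) tendsto_const[of c F] assms(3,1)] by (simp)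

lemma jacobi_weight_end_limits:
  assumes "\<alpha> > 0" "\<beta> > 0" and "continuous_on UNIV (g :: real \<Rightarrow> real)"
  shows "((\<lambda>x. jacobi_weight \<alpha> \<beta> x * g x) \<longlongrightarrow> 0) (at_left 1)"
    and "((\<lambda>x. jacobi_weight \<alpha> \<beta> x * g x) \<longlongrightarrow> 0) (at_right (-1))"
proof -
  have "isCont g x" for x using assms(3) continuous_on_eq_continuous_at by blast
  then have g: "(g \<longlongrightarrow> g x) (at x within S)" for x S
    by (metis continuous_at_imp_continuous_at_within continuous_within)
  have ev1: "\<forall>\<^sub>F x in at_left (1::real). 0 \<le> 1 - x \<and> 0 \<le> 1 + x"
    by (rule eventually_mono[OF eventually_at_left_real[of "0" 1]]) auto
  have ev2: "\<forall>\<^sub>F x in at_right (-1::real). 0 \<le> 1 - x \<and> 0 \<le> 1 + x"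
    by (rule eventually_mono[OF eventually_at_right_real[of "-1" 0]]) auto
  have t1: "((\<lambda>x. (1 - x) powr \<alpha>) \<longlongrightarrow> 0) (at_left (1::real))"
    by (rule tendsto_powr_0_at[OF assms(1)])
       (auto intro!: tendsto_eq_intros eventually_mono[OF ev1])
  have t2: "((\<lambda>x. (1 + x) powr \<beta>) \<longlongrightarrow> 2 powr \<beta>) (at_left (1::real))"
    by (auto intro!: tendsto_eq_intros)
  have t3: "((\<lambda>x. (1 - x) powr \<alpha>) \<longlongrightarrow> 2 powr \<alpha>) (at_right (-1::real))"
    by (auto intro!: tendsto_eq_intros)
  have t4: "((\<lambda>x. (1 + x) powr \<beta>) \<longlongrightarrow> 0) (at_right (-1::real))"
    by (rule tendsto_powr_0_at[OF assms(2)])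
       (auto intro!: tendsto_eq_intros eventually_mono[OF ev2])
  show "((\<lambda>x. jacobi_weight \<alpha> \<beta> x * g x) \<longlongrightarrow> 0) (at_left 1)"
    unfolding jacobi_weight_def
    using tendsto_mult[OF tendsto_mult[OF t1 t2] g] by simp
  show "((\<lambda>x. jacobi_weight \<alpha> \<beta> x * g x) \<longlongrightarrow> 0) (at_right (-1))"
    unfolding jacobi_weight_def
    using tendsto_mult[OF tendsto_mult[OF t3 t4] g] by simp
qed

lemma integrable_powr_ends:
  fixes c :: real
  assumes "c > -1"
  shows "set_integrable lborel {-1<..<1} (\<lambda>x. (1 + x) powr c)"
    and "set_integrable lborel {-1<..<1} (\<lambda>x. (1 - x) powr c)"
proof -
  have p: "((\<lambda>x. (1 + x) powr (c+1) / (c+1)) \<longlongrightarrow> 2 powr (c+1) / (c+1)) (at_left (1::real))"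
    using assms by (auto intro!: tendsto_eq_intros)
  have p2: "((\<lambda>x. (1 + x) powr (c+1) / (c+1)) \<longlongrightarrow> 0) (at_right (-1::real))"
    using assms by (auto intro!: tendsto_eq_intros tendsto_powr_0_at
       eventually_mono[OF eventually_at_right_real[of "-1" 0]])
  have "set_integrable lborel (einterval (ereal (-1)) (ereal 1)) (\<lambda>x. (1 + x) powr c)"
  proof (rule interval_integral_FTC_nonneg(1))
    fix x :: real assume "ereal (-1) < ereal x" "ereal x < ereal 1"
    then have x: "-1 < x" "x < 1" by auto
    show "((\<lambda>x::real. (1 + x) powr (c+1) / (c+1)) has_real_derivative (1 + x) powr c) (at x)"
      using x assms by (auto intro!: derivative_eq_intros)
    show "isCont (\<lambda>x. (1 + x) powr c) x"
      using x by (auto intro!: continuous_intros)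
  next
    show "(((\<lambda>x. (1 + x) powr (c+1) / (c+1)) \<circ> real_of_ereal) \<longlongrightarrow> 0) (at_right (ereal (-1)))"
      using p2 by (simp only: ereal_tendsto_simps)
    show "(((\<lambda>x. (1 + x) powr (c+1) / (c+1)) \<circ> real_of_ereal) \<longlongrightarrow> 2 powr (c+1) / (c+1)) (at_left (ereal 1))"
      using p by (simp only: ereal_tendsto_simps)
  qed auto
  then show 1: "set_integrable lborel {-1<..<1} (\<lambda>x. (1 + x) powr c)"
    by (simp add: einterval_eq)
  have "set_integrable lborel {-1<..<1} (\<lambda>x. (1 + x) powr c) \<longleftrightarrow>
    set_integrable lborel {-1<..<1} (\<lambda>x. (1 - x) powr c)"
    using lborel_integrable_real_affine_iff[of "-1" "\<lambda>x. indicator {-1<..<1} x * (1 + x) powr c" 0]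
    by (simp add: set_integrable_def indicator_def conj_commute)
  with 1 show "set_integrable lborel {-1<..<1} (\<lambda>x. (1 - x) powr c)" by simp
qed

text \<open>At each of the two endpoints only one factor of the weight can be unbounded, so a constant multiple
of \<open>(1 - x)\<^sup>\<alpha> + (1 + x)\<^sup>\<beta>\<close> dominates the weight.\<close>

lemma integrable_jacobi_weight_poly:
  assumes "\<alpha> > -1" "\<beta> > -1"
  shows "set_integrable lborel {-1<..<1} (\<lambda>x. jacobi_weight \<alpha> \<beta> x * poly q x)"
proof -
  define K where "K = 1 + 2 powr \<alpha> + 2 powr \<beta>"
  \<comment> \<open>The factor belonging to the far endpoint has its base in \<open>[1, 2]\<close>; its exponent may have either sign.\<close>
  have le: "t powr c \<le> 1 + 2 powr c" if "1 \<le> t" "t \<le> 2" for t c :: real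
  proof (cases "c \<ge> 0")
    case True
    then have "t powr c \<le> 2 powr c" using that by (intro powr_mono2) auto
    then show ?thesis by simp
  next
    case False
    then have "t powr c \<le> t powr 0" using that by (intro powr_mono) auto
    then have "t powr c \<le> 1" using that by simp
    then show ?thesis using powr_ge_zero[of 2 c] by linarith
  qed
  have wb: "jacobi_weight \<alpha> \<beta> x \<le> K * ((1 - x) powr \<alpha> + (1 + x) powr \<beta>)"
    if "x \<in> {-1<..<1}" for x
  proof (cases "x \<ge> 0")
    case True
    then have "(1 + x) powr \<beta> \<le> K" using le[of "1 + x" \<beta>] that powr_ge_zero[of 2 \<alpha>]
      unfolding K_def greaterThanLessThan_iff by linarith
    then have "jacobi_weight \<alpha> \<beta> x \<le> (1 - x) powr \<alpha> * K"
      unfolding jacobi_weight_def by (intro mult_left_mono) auto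
    also have "\<dots> \<le> K * ((1 - x) powr \<alpha> + (1 + x) powr \<beta>)"
      unfolding K_def by (simp add: algebra_simps)
    finally show ?thesis .
  next
    case False
    then have "(1 - x) powr \<alpha> \<le> K" using le[of "1 - x" \<alpha>] that powr_ge_zero[of 2 \<beta>]
      unfolding K_def greaterThanLessThan_iff by linarith
    then have "jacobi_weight \<alpha> \<beta> x \<le> K * (1 + x) powr \<beta>"
      unfolding jacobi_weight_def by (intro mult_right_mono) auto
    also have "\<dots> \<le> K * ((1 - x) powr \<alpha> + (1 + x) powr \<beta>)"
      unfolding K_def by (simp add: algebra_simps)
    finally show ?thesis .
  qed
  have "compact ((\<lambda>x. poly q x) ` {-1..1})"
    by (intro compact_continuous_image continuous_intros) auto
  then obtain B where B: "\<And>x. x \<in> {-1..1} \<Longrightarrow> \<bar>poly q x\<bar> \<le> B"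
    using compact_imp_bounded bounded_iff by (metis image_eqI real_norm_def)
  have B0: "B \<ge> 0" using B[of 0] by (metis abs_ge_zero atLeastAtMost_iff order_trans
      le_minus_one_simps(1) zero_le_one)
  have int: "set_integrable lborel {-1<..<1}
      (\<lambda>x. B * K * ((1 - x) powr \<alpha> + (1 + x) powr \<beta>))"
    using integrable_powr_ends[of \<alpha>] integrable_powr_ends[of \<beta>] assms
    by (intro set_integrable_mult_right set_integral_add) auto
  show ?thesis
  proof (rule set_integrable_bound[OF int])
    show "set_borel_measurable lborel {-1<..<1} (\<lambda>x. jacobi_weight \<alpha> \<beta> x * poly q x)"
      unfolding set_borel_measurable_def jacobi_weight_def
      by (intro measurable_completion borel_measurable_scaleR borel_measurable_times) 
         (auto intro!: borel_measurable_continuous_onI continuous_intros)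
    show "AE x in lborel. x \<in> {-1<..<1} \<longrightarrow>
      norm (jacobi_weight \<alpha> \<beta> x * poly q x) \<le>
      norm (B * K * ((1 - x) powr \<alpha> + (1 + x) powr \<beta>))"
    proof (intro AE_I2 impI)
      fix x :: real assume x: "x \<in> {-1<..<1}"
      have w0: "jacobi_weight \<alpha> \<beta> x \<ge> 0" by (simp add: jacobi_weight_def)
      have "norm (jacobi_weight \<alpha> \<beta> x * poly q x) = jacobi_weight \<alpha> \<beta> x * \<bar>poly q x\<bar>"
        using w0 by (simp add: abs_mult)
      also have "\<dots> \<le> (K * ((1 - x) powr \<alpha> + (1 + x) powr \<beta>)) * B"
        using wb[OF x] B[of x] x w0 by (intro mult_mono) auto
      also have "\<dots> \<le> norm (B * K * ((1 - x) powr \<alpha> + (1 + x) powr \<beta>))"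
        by (simp add: mult_ac)
      finally show "norm (jacobi_weight \<alpha> \<beta> x * poly q x) \<le>
        norm (B * K * ((1 - x) powr \<alpha> + (1 + x) powr \<beta>))" .
    qed
  qed
qed

lemma jacobi_integral_linear:
  assumes "\<alpha> > -1" "\<beta> > -1"
  shows "(LBINT x:{-1<..<1}. jacobi_weight \<alpha> \<beta> x * poly (p + smult c q) x) =
    (LBINT x:{-1<..<1}. jacobi_weight \<alpha> \<beta> x * poly p x) +
    c * (LBINT x:{-1<..<1}. jacobi_weight \<alpha> \<beta> x * poly q x)"
proof -
  have "(LBINT x:{-1<..<1}. jacobi_weight \<alpha> \<beta> x * poly (p + smult c q) x) =
    (LBINT x:{-1<..<1}. jacobi_weight \<alpha> \<beta> x * poly p x +
       jacobi_weight \<alpha> \<beta> x * poly (smult c q) x)"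
    by (simp add: algebra_simps)
  also have "\<dots> = (LBINT x:{-1<..<1}. jacobi_weight \<alpha> \<beta> x * poly p x) +
      (LBINT x:{-1<..<1}. jacobi_weight \<alpha> \<beta> x * poly (smult c q) x)"
    by (intro set_integral_add integrable_jacobi_weight_poly assms)
  also have "(LBINT x:{-1<..<1}. jacobi_weight \<alpha> \<beta> x * poly (smult c q) x) =
      (LBINT x:{-1<..<1}. c * (jacobi_weight \<alpha> \<beta> x * poly q x))"
    by (simp add: mult_ac)
  finally show ?thesis by simp
qed

text \<open>Green's formula: the integrand is the derivative of the weighted Wronskian of \<open>f\<close> and \<open>g\<close>, which
tends to 0 at both endpoints.\<close>

lemma jacobi_green:
  assumes "\<alpha> > -1" "\<beta> > -1"
  shows "(LBINT x:{-1<..<1}. jacobi_weight \<alpha> \<beta> x *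
    poly (f * jacobi_op \<alpha> \<beta> g - g * jacobi_op \<alpha> \<beta> f) x) = 0"
proof -
  let ?G = "\<lambda>x. jacobi_weight (\<alpha> + 1) (\<beta> + 1) x * poly (f * pderiv g - g * pderiv f) x"
  let ?S = "\<lambda>x. jacobi_weight \<alpha> \<beta> x * poly (f * jacobi_op \<alpha> \<beta> g - g * jacobi_op \<alpha> \<beta> f) x"
  have "(LBINT x=ereal (-1)..ereal 1. ?S x) = 0 - 0"
  proof (rule interval_integral_FTC_integrable[where F = ?G])
    fix x :: real assume "ereal (-1) < ereal x" "ereal x < ereal 1"
    then have x: "-1 < x" "x < 1" by auto
    have "((\<lambda>x. poly f x * (jacobi_weight (\<alpha> + 1) (\<beta> + 1) x * poly (pderiv g) x) -
       poly g x * (jacobi_weight (\<alpha> + 1) (\<beta> + 1) x * poly (pderiv f) x))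
      has_real_derivative ?S x) (at x)"
      by (rule derivative_eq_intros DERIV_jacobi_flux poly_DERIV x refl)+
         (simp add: algebra_simps)
    then have "(?G has_real_derivative ?S x) (at x)" by (simp add: algebra_simps)
    then show "(?G has_vector_derivative ?S x) (at x)"
      by (simp add: has_real_derivative_iff_has_vector_derivative)
    show "isCont ?S x"
      using x unfolding jacobi_weight_def by (auto intro!: continuous_intros)
  next
    show "set_integrable lborel (einterval (ereal (-1)) (ereal 1)) ?S"
      using integrable_jacobi_weight_poly[OF assms] by (simp only: einterval_eq)
    have c: "continuous_on UNIV (poly (f * pderiv g - g * pderiv f))"
      by (intro continuous_intros)
    show "((?G \<circ> real_of_ereal) \<longlongrightarrow> 0) (at_right (ereal (-1)))"
      "((?G \<circ> real_of_ereal) \<longlongrightarrow> 0) (at_left (ereal 1))"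
      unfolding ereal_tendsto_simps
      by (rule jacobi_weight_end_limits[OF _ _ c]; use assms in simp)+
  qed simp
  then show ?thesis by (simp add: interval_lebesgue_integral_def einterval_eq)
qed

text \<open>Let \<open>\<lambda>\<^sub>m\<close> denote the eigenvalues and \<open>L\<close> the operator. Green's formula, applied to the eigenfunction
and \<open>q\<close>, says that the eigenfunction is orthogonal to \<open>L q + \<lambda>\<^sub>n q\<close>. If \<open>q\<close> has degree \<open>m < n\<close>, this
polynomial is \<open>(\<lambda>\<^sub>n - \<lambda>\<^sub>m) q\<close> plus a polynomial of lower degree, and \<open>\<lambda>\<^sub>m < \<lambda>\<^sub>n\<close>; so the
claim follows by induction on the degree.\<close>

lemma jacobi_sol_orthogonal:
  assumes "\<alpha> > -1" "\<beta> > -1"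
  shows "degree q < n \<Longrightarrow>
    (LBINT x:{-1<..<1}. jacobi_weight \<alpha> \<beta> x * poly (jacobi_sol \<alpha> \<beta> n * q) x) = 0"
proof (induction "degree q" arbitrary: q rule: less_induct)
  case less
  let ?y = "jacobi_sol \<alpha> \<beta> n" and ?I = "\<lambda>p. (LBINT x:{-1<..<1}. jacobi_weight \<alpha> \<beta> x * poly p x)"
  define c where "c = jacobi_eig \<alpha> \<beta> n - jacobi_eig \<alpha> \<beta> (degree q)"
  define r where "r = jacobi_op \<alpha> \<beta> q + smult (jacobi_eig \<alpha> \<beta> (degree q)) q"
  have c: "c > 0" using jacobi_eig_less[OF assms less.prems] by (simp add: c_def)
  have rc: "coeff r i = 0" if "i \<ge> degree q" for i
  proof (cases "i = degree q")
    case True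
    then show ?thesis by (simp add: r_def coeff_jacobi_op coeff_eq_0)
  next
    case False
    then show ?thesis using that by (simp add: r_def coeff_jacobi_op coeff_eq_0)
  qed
  have "?I (?y * r) = 0"
  proof (cases "degree q = 0")
    case True
    then have "r = 0" using rc by (intro poly_eqI) auto
    then show ?thesis by simp
  next
    case False
    then have "degree r < degree q" using rc
      by (metis gr0I le_neq_implies_less leading_coeff_0_iff degree_0 not_le)
    then show ?thesis using less by simp
  qed
  moreover have "?I (?y * r + smult c (?y * q)) = 0"
    using jacobi_green[OF assms, of ?y q] jacobi_sol_ode[OF assms(1), of \<beta> n]
    by (simp add: r_def c_def algebra_simps smult_diff_left)
  ultimately show ?case
    using c by (simp only: jacobi_integral_linear[OF assms]) simp
qed

lemma jacobi_weight_square_integral_0: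
  assumes "\<alpha> > -1" "\<beta> > -1"
    and "(LBINT x:{-1<..<1}. jacobi_weight \<alpha> \<beta> x * poly (d * d) x) = 0"
  shows "d = 0"
proof (rule ccontr)
  assume "d \<noteq> 0"
  have "AE x in lborel. indicator {-1<..<1} x *\<^sub>R (jacobi_weight \<alpha> \<beta> x * poly (d * d) x) = 0"
  proof (subst integral_nonneg_eq_0_iff_AE[symmetric])
    show "integrable lborel (\<lambda>x. indicator {-1<..<1} x *\<^sub>R (jacobi_weight \<alpha> \<beta> x * poly (d * d) x))"
      using integrable_jacobi_weight_poly[OF assms(1,2)] by (simp only: set_integrable_def)
  qed (use assms(3) in \<open>auto simp: set_lebesgue_integral_def jacobi_weight_def\<close>)
  moreover have "AE x in lborel. x \<notin> {x. poly d x = 0}"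
    by (rule AE_not_in) (simp add: \<open>d \<noteq> 0\<close> poly_roots_finite finite_imp_null_set_lborel)
  ultimately have "AE x in lborel. x \<notin> {-1<..<1::real}"
    by eventually_elim (auto simp: indicator_def jacobi_weight_def split: if_splits)
  then have "{-1<..<1::real} \<in> null_sets lborel"
    by (subst (asm) AE_iff_null_sets[symmetric]) auto
  then show False by (simp add: null_sets_def)
qed

text \<open>Subtracting from a second candidate the multiple of the hypergeometric one with the same leading
coefficient leaves a polynomial of degree less than \<open>n\<close> that is orthogonal to itself. Hence the two
are proportional, and the positive value at 1 fixes the factor.\<close>

lemma jacobi_poly_eq:
  assumes "\<alpha> > -1" "\<beta> > -1"
  shows "jacobi_poly \<alpha> \<beta> n = jacobi_sol \<alpha> \<beta> n"
  unfolding jacobi_poly_def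
proof (rule the_equality)
  let ?I = "\<lambda>p. (LBINT x:{-1<..<1}. jacobi_weight \<alpha> \<beta> x * poly p x)"
  let ?y = "jacobi_sol \<alpha> \<beta> n"
  have form: "(LBINT x:{-1<..<1}. poly p x * poly q x * ((1 - x) powr \<alpha> * (1 + x) powr \<beta>))
    = ?I (p * q)" for p q
    by (simp add: jacobi_weight_def mult_ac)
  show "is_jacobi_poly \<alpha> \<beta> n ?y"
    unfolding is_jacobi_poly_def form
    using degree_jacobi_sol jacobi_sol_orthogonal jacobi_sol_at_1 assms by auto
  fix p assume "is_jacobi_poly \<alpha> \<beta> n p"
  then have p: "degree p = n" "\<And>q. degree q < n \<Longrightarrow> ?I (p * q) = 0" "poly p 1 = poly ?y 1"
    unfolding is_jacobi_poly_def form by (auto simp: jacobi_sol_at_1)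
  have y1: "poly ?y 1 > 0" using assms by (auto simp: jacobi_sol_at_1 intro!: divide_pos_pos pochhammer_pos)
  show "p = ?y"
  proof (cases "n = 0")
    case True
    obtain a b where "p = [:a:]" "?y = [:b:]"
      using degree_jacobi_sol[OF assms, of n] p(1) True by (metis degree_eq_zeroE)
    then show ?thesis using p(3) by simp
  next
    case False
    define c where "c = lead_coeff p / lead_coeff ?y"
    have y0: "lead_coeff ?y \<noteq> 0" using y1 by auto
    define d where "d = p + smult (- c) ?y"
    have "coeff d i = 0" if "i \<ge> n" for i
      using y0 that p(1) degree_jacobi_sol[OF assms, of n]
      by (cases "i = n") (auto simp: d_def c_def coeff_eq_0)
    then have dd: "degree d < n"
      using False by (metis gr0I le_neq_implies_less leading_coeff_0_iff degree_0 not_le)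
    have "d * d = p * d + smult (- c) (?y * d)"
      using arg_cong[OF d_def, of "\<lambda>z. z * d"] by (simp add: algebra_simps)
    then have "?I (d * d) = ?I (p * d) + (- c) * ?I (?y * d)"
      by (simp only: jacobi_integral_linear[OF assms])
    also have "\<dots> = 0" using p(2)[OF dd] jacobi_sol_orthogonal[OF assms dd] by simp
    finally have "d = 0" by (rule jacobi_weight_square_integral_0[OF assms])
    then have "p = smult c ?y" by (simp add: d_def)
    moreover from this have "c = 1" using p(3) y1 by simp
    ultimately show ?thesis by simp
  qed
qed

section \<open>Sturm comparison with singular endpoints\<close>

lemma nonzero_imp_constant_sign:
  fixes f :: "real \<Rightarrow> real"
  assumes "continuous_on {a<..<b} f" "\<And>t. t \<in> {a<..<b} \<Longrightarrow> f t \<noteq> 0"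
  obtains \<epsilon> where "\<epsilon> \<noteq> 0" "\<And>t. t \<in> {a<..<b} \<Longrightarrow> \<epsilon> * f t > 0"
proof -
  have False if "s \<in> {a<..<b}" "t \<in> {a<..<b}" "f s < 0" "f t > 0" for s t
  proof -
    have "is_interval (f ` {a<..<b})"
      using connected_continuous_image[OF assms(1)] by (simp add: is_interval_connected_1)
    then have "0 \<in> f ` {a<..<b}"
      by (rule mem_is_interval_1_I[of _ "f s" "f t"]) (use that in auto)
    then show False using assms(2) by auto
  qed
  then have "(\<forall>t\<in>{a<..<b}. f t > 0) \<or> (\<forall>t\<in>{a<..<b}. f t < 0)"
    using assms(2) by (metis linorder_neqE_linordered_idom)
  then show ?thesis
    using that[of 1] that[of "-1"] by auto
qed

text \<open>If \<open>g\<close> had no zero, both functions would have constant sign on \<open>(a, b)\<close>, without loss of generality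
positive. The derivative of the Wronskian \<open>W\<close> is \<open>(qf - qg) f g < 0\<close>, so \<open>W\<close> would strictly decrease. But at
a zero \<open>a\<close> of \<open>f\<close> one has \<open>W = - p f' g \<le> 0\<close>, and at a zero \<open>b\<close> one has \<open>W \<ge> 0\<close>. At an
endpoint where the equation is singular, the assumption that \<open>W\<close> tends to 0 takes over the role of
these inequalities. The proof is given for an equation in self-adjoint form because it is used
twice: in the variable \<open>x\<close>, with \<open>p = (1 - x)\<^bsup>\<alpha> + 1\<^esup> (1 + x)\<^bsup>\<beta> + 1\<^esup>\<close>, to count zeros, and with \<open>p = 1\<close>
after the Liouville transformation.\<close>

lemma sturm_comparison_gap:
  fixes f f' g g' p qf qg :: "real \<Rightarrow> real" and a b l r :: real
  defines "W \<equiv> \<lambda>t. f t * (p t * g' t) - g t * (p t * f' t)"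
  assumes f: "\<And>t. l < t \<Longrightarrow> t < r \<Longrightarrow> (f has_real_derivative f' t) (at t)"
    and g: "\<And>t. l < t \<Longrightarrow> t < r \<Longrightarrow> (g has_real_derivative g' t) (at t)"
    and pf: "\<And>t. l < t \<Longrightarrow> t < r \<Longrightarrow> ((\<lambda>t. p t * f' t) has_real_derivative - qf t * f t) (at t)"
    and pg: "\<And>t. l < t \<Longrightarrow> t < r \<Longrightarrow> ((\<lambda>t. p t * g' t) has_real_derivative - qg t * g t) (at t)"
    and p: "\<And>t. l < t \<Longrightarrow> t < r \<Longrightarrow> p t > 0"
    and q: "\<And>t. l < t \<Longrightarrow> t < r \<Longrightarrow> qf t < qg t"
    and ab: "l \<le> a" "a < b" "b \<le> r"
    and nz: "\<And>t. a < t \<Longrightarrow> t < b \<Longrightarrow> f t \<noteq> 0"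
    and left: "(l < a \<and> f a = 0) \<or> (a = l \<and> (W \<longlongrightarrow> 0) (at_right l))"
    and right: "(b < r \<and> f b = 0) \<or> (b = r \<and> (W \<longlongrightarrow> 0) (at_left r))"
  shows "\<exists>t. a < t \<and> t < b \<and> g t = 0"
proof (rule ccontr)
  assume "\<not> ?thesis"
  then have gnz: "g t \<noteq> 0" if "t \<in> {a<..<b}" for t using that by auto
  have sub: "l < t \<and> t < r" if "t \<in> {a<..<b}" for t using that ab by auto
  have cf: "isCont f t" and cg: "isCont g t" and cW: "isCont W t"
    and DW: "(W has_real_derivative (qf t - qg t) * (f t * g t)) (at t)"
    if "l < t" "t < r" for t
  proof -
    show "isCont f t" "isCont g t"
      using f[OF that] g[OF that] DERIV_isCont by blast+
    have "(W has_real_derivative f' t * (p t * g' t) + - qg t * g t * f t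
       - (g' t * (p t * f' t) + - qf t * f t * g t)) (at t)"
      unfolding W_def
      by (rule DERIV_diff[OF DERIV_mult[OF f[OF that] pg[OF that]] DERIV_mult[OF g[OF that] pf[OF that]]])
    then show "(W has_real_derivative (qf t - qg t) * (f t * g t)) (at t)"
      by (simp add: algebra_simps)
    then show "isCont W t" by (rule DERIV_isCont)
  qed
  \<comment> \<open>The factors \<open>\<epsilon>\<close> and \<open>\<delta>\<close> normalise the signs of \<open>f\<close> and \<open>g\<close> on the gap.\<close>
  obtain \<epsilon> where \<epsilon>: "\<epsilon> \<noteq> 0" "\<And>t. t \<in> {a<..<b} \<Longrightarrow> \<epsilon> * f t > 0"
  proof (rule nonzero_imp_constant_sign[of a b f])
    show "continuous_on {a<..<b} f"
      using cf sub by (intro continuous_at_imp_continuous_on) blast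
  qed (use nz in auto)
  obtain \<delta> where \<delta>: "\<delta> \<noteq> 0" "\<And>t. t \<in> {a<..<b} \<Longrightarrow> \<delta> * g t > 0"
  proof (rule nonzero_imp_constant_sign[of a b g])
    show "continuous_on {a<..<b} g"
      using cg sub by (intro continuous_at_imp_continuous_on) blast
  qed (use gnz in auto)
  define V where "V t = \<epsilon> * \<delta> * W t" for t
  have dec: "V t < V s" if "a < s" "s < t" "t < b" for s t
  proof (rule DERIV_neg_imp_decreasing[OF \<open>s < t\<close>])
    fix u assume u: "s \<le> u" "u \<le> t"
    then have u': "u \<in> {a<..<b}" using that by auto
    have "(V has_real_derivative \<epsilon> * \<delta> * ((qf u - qg u) * (f u * g u))) (at u)"
      unfolding V_def using DERIV_cmult[OF DW] sub[OF u'] by blast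
    moreover have "(qf u - qg u) * ((\<epsilon> * f u) * (\<delta> * g u)) < 0"
      using mult_pos_pos[OF \<epsilon>(2)[OF u'] \<delta>(2)[OF u']] q[of u] sub[OF u']
      by (intro mult_neg_pos) auto
    ultimately show "\<exists>y. (V has_real_derivative y) (at u) \<and> y < 0"
      by (auto simp: mult_ac)
  qed
  have isl: "\<exists>A\<le>0. (V \<longlongrightarrow> A) (at_right a)"
    using left
  proof
    assume "a = l \<and> (W \<longlongrightarrow> 0) (at_right l)"
    then show ?thesis unfolding V_def using tendsto_mult_right_zero by blast
  next
    assume la: "l < a \<and> f a = 0"
    have ar: "a < r" using ab by simp
    have lim: "(h \<longlongrightarrow> h a) (at_right a)" if "isCont h a" for h :: "real \<Rightarrow> real"
      using that continuous_at_imp_continuous_at_within continuous_within by blast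
    have ga: "\<delta> * g a \<ge> 0"
    proof (rule tendsto_lowerbound[OF tendsto_mult_left[OF lim[OF cg]]])
      show "\<forall>\<^sub>F t in at_right a. 0 \<le> \<delta> * g t"
        using \<delta>(2) by (intro eventually_mono[OF eventually_at_right_real[OF ab(2)]]) force
    qed (use la ar in auto)
    \<comment> \<open>A negative slope at its zero \<open>a\<close> would make the positive function negative next to \<open>a\<close>.\<close>
    have fa: "\<epsilon> * f' a \<ge> 0"
    proof (rule ccontr)
      assume "\<not> ?thesis"
      then have "\<epsilon> * f' a < 0" by simp
      then obtain d where d: "d > 0" "\<And>h. h > 0 \<Longrightarrow> h < d \<Longrightarrow> \<epsilon> * f (a + h) < \<epsilon> * f a"
        using DERIV_neg_dec_right[OF DERIV_cmult[OF f[of a]]] la ar by blast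
      define h where "h = min (d/2) ((b - a)/2)"
      have "h > 0" "h < d" "a + h \<in> {a<..<b}" using d(1) ab by (auto simp: h_def min_def field_simps)
      then show False using d(2)[of h] \<epsilon>(2)[of "a + h"] la by auto
    qed
    have "(V \<longlongrightarrow> V a) (at_right a)"
      unfolding V_def using tendsto_mult_left[OF lim[OF cW]] la ar by blast
    moreover have "V a = - (p a * ((\<delta> * g a) * (\<epsilon> * f' a)))"
      unfolding V_def W_def using la by simp
    moreover have "p a * ((\<delta> * g a) * (\<epsilon> * f' a)) \<ge> 0"
      using mult_nonneg_nonneg[OF less_imp_le[OF p[OF conjunct1[OF la] ar]]
          mult_nonneg_nonneg[OF ga fa]] by simp
    ultimately show ?thesis by (intro exI[of _ "V a"]) auto
  qed
  have isr: "\<exists>B\<ge>0. (V \<longlongrightarrow> B) (at_left b)"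
    using right
  proof
    assume "b = r \<and> (W \<longlongrightarrow> 0) (at_left r)"
    then show ?thesis unfolding V_def using tendsto_mult_right_zero by blast
  next
    assume la: "b < r \<and> f b = 0"
    have ar: "l < b" using ab by simp
    have lim: "(h \<longlongrightarrow> h b) (at_left b)" if "isCont h b" for h :: "real \<Rightarrow> real"
      using that continuous_at_imp_continuous_at_within continuous_within by blast
    have ga: "\<delta> * g b \<ge> 0"
    proof (rule tendsto_lowerbound[OF tendsto_mult_left[OF lim[OF cg]]])
      show "\<forall>\<^sub>F t in at_left b. 0 \<le> \<delta> * g t"
        using \<delta>(2) by (intro eventually_mono[OF eventually_at_left_real[OF ab(2)]]) force
    qed (use la ar in auto)
    have fa: "\<epsilon> * f' b \<le> 0"
    proof (rule ccontr)
      assume "\<not> ?thesis"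
      then have "\<epsilon> * f' b > 0" by simp
      then obtain d where d: "d > 0" "\<And>h. h > 0 \<Longrightarrow> h < d \<Longrightarrow> \<epsilon> * f (b - h) < \<epsilon> * f b"
        using DERIV_pos_inc_left[OF DERIV_cmult[OF f[of b]]] la ar by blast
      define h where "h = min (d/2) ((b - a)/2)"
      have "h > 0" "h < d" "b - h \<in> {a<..<b}" using d(1) ab by (auto simp: h_def min_def field_simps)
      then show False using d(2)[of h] \<epsilon>(2)[of "b - h"] la by auto
    qed
    have "(V \<longlongrightarrow> V b) (at_left b)"
      unfolding V_def using tendsto_mult_left[OF lim[OF cW]] la ar by blast
    moreover have "V b = p b * ((\<delta> * g b) * (- (\<epsilon> * f' b)))"
      unfolding V_def W_def using la by simp
    moreover have "p b * ((\<delta> * g b) * (- (\<epsilon> * f' b))) \<ge> 0"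
      using mult_nonneg_nonneg[OF less_imp_le[OF p[OF ar conjunct1[OF la]]]
          mult_nonneg_nonneg[OF ga, of "- (\<epsilon> * f' b)"]] fa by simp
    ultimately show ?thesis by (intro exI[of _ "V b"]) auto
  qed
  define c where "c = (a + b) / 2"
  have c: "a < c" "c < b" using ab by (auto simp: c_def)
  from isl obtain A where A: "A \<le> 0" "(V \<longlongrightarrow> A) (at_right a)" by (elim exE conjE)
  from isr obtain B where B: "B \<ge> 0" "(V \<longlongrightarrow> B) (at_left b)" by (elim exE conjE)
  \<comment> \<open>Two inner points turn the strict decrease into a strict inequality between the one-sided limits.\<close>
  define s t where "s = (a + c) / 2" and "t = (c + b) / 2"
  have st: "a < s" "s < c" "c < t" "t < b" using c by (simp_all add: s_def t_def)
  have "V s \<le> A"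
    using A(2) by (rule tendsto_lowerbound)
      (use st dec in \<open>auto intro!: eventually_mono[OF eventually_at_right_real[OF st(1)]] less_imp_le\<close>)
  moreover have "V t \<ge> B"
    using B(2) by (rule tendsto_upperbound)
      (use st dec in \<open>auto intro!: eventually_mono[OF eventually_at_left_real[OF st(4)]] less_imp_le\<close>)
  moreover have "V t < V s" using dec st by auto
  ultimately show False using A B by linarith
qed

text \<open>The largest zero of \<open>f\<close> below \<open>b\<close>, or \<open>l\<close> if there is none, is the left end of a gap ending at \<open>b\<close>.
The conclusion is phrased without naming that predecessor, in the form used to compare
sorted lists of zeros.\<close>

lemma sturm_comparison:
  fixes f f' g g' p qf qg :: "real \<Rightarrow> real" and b l r :: real
  defines "W \<equiv> \<lambda>t. f t * (p t * g' t) - g t * (p t * f' t)"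
  assumes f: "\<And>t. l < t \<Longrightarrow> t < r \<Longrightarrow> (f has_real_derivative f' t) (at t)"
    and g: "\<And>t. l < t \<Longrightarrow> t < r \<Longrightarrow> (g has_real_derivative g' t) (at t)"
    and pf: "\<And>t. l < t \<Longrightarrow> t < r \<Longrightarrow> ((\<lambda>t. p t * f' t) has_real_derivative - qf t * f t) (at t)"
    and pg: "\<And>t. l < t \<Longrightarrow> t < r \<Longrightarrow> ((\<lambda>t. p t * g' t) has_real_derivative - qg t * g t) (at t)"
    and p: "\<And>t. l < t \<Longrightarrow> t < r \<Longrightarrow> p t > 0"
    and q: "\<And>t. l < t \<Longrightarrow> t < r \<Longrightarrow> qf t < qg t"
    and b: "l < b" "b \<le> r"
    and fin: "finite {t. l < t \<and> t < r \<and> f t = 0}"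
    and left: "(W \<longlongrightarrow> 0) (at_right l)"
    and right: "(b < r \<and> f b = 0) \<or> (b = r \<and> (W \<longlongrightarrow> 0) (at_left r))"
  shows "\<exists>t. l < t \<and> t < b \<and> g t = 0 \<and> (\<forall>z. l < z \<and> z < b \<and> f z = 0 \<longrightarrow> z < t)"
proof -
  define Z where "Z = insert l {t. l < t \<and> t < b \<and> f t = 0}"
  have "finite Z"
    unfolding Z_def using b by (intro finite.insertI finite_subset[OF _ fin]) auto
  define a where "a = Max Z"
  have aZ: "a \<in> Z" unfolding a_def using \<open>finite Z\<close> by (intro Max_in) (auto simp: Z_def)
  have amax: "z \<le> a" if "z \<in> Z" for z unfolding a_def using \<open>finite Z\<close> that by (rule Max_ge)
  have "\<exists>t. a < t \<and> t < b \<and> g t = 0"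
  proof (rule sturm_comparison_gap[OF f g pf pg p q])
    show "l \<le> a" "a < b" "b \<le> r" using aZ b by (auto simp: Z_def)
    show "f t \<noteq> 0" if "a < t" "t < b" for t
    proof
      assume "f t = 0"
      with that \<open>l \<le> a\<close> have "t \<in> Z" by (auto simp: Z_def)
      with amax that show False by force
    qed
    show "(l < a \<and> f a = 0) \<or>
      (a = l \<and> ((\<lambda>t. f t * (p t * g' t) - g t * (p t * f' t)) \<longlongrightarrow> 0) (at_right l))"
      using aZ left by (auto simp: Z_def W_def)
    show "(b < r \<and> f b = 0) \<or>
      (b = r \<and> ((\<lambda>t. f t * (p t * g' t) - g t * (p t * f' t)) \<longlongrightarrow> 0) (at_left r))"
      using right by (auto simp: W_def)
  qed
  then obtain t where t: "a < t" "t < b" "g t = 0" by blast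
  have "z < t" if "l < z" "z < b" "f z = 0" for z
    using amax[of z] that t by (auto simp: Z_def)
  moreover have "l < t" using aZ t by (auto simp: Z_def)
  ultimately show ?thesis using t by blast
qed

section \<open>Sorted lists of interlacing sets\<close>

text \<open>Choosing for each \<open>b\<close> in \<open>F\<close> an element of \<open>G\<close> in the gap below \<open>b\<close> gives an injection, since different
gaps are disjoint. It sends the first \<open>k + 1\<close> elements of \<open>F\<close> to elements of \<open>G\<close> below the last of
them; so at least \<open>k + 1\<close> elements of \<open>G\<close> lie below the element of \<open>F\<close> at position \<open>k\<close>.\<close>

lemma sorted_list_of_set_gap:
  fixes F G :: "real set"
  assumes "finite F" "finite G"
    and gap: "\<And>b. b \<in> F \<Longrightarrow> \<exists>t\<in>G. t < b \<and> (\<forall>z\<in>F. z < b \<longrightarrow> z < t)"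
  shows "card F \<le> card G"
    and "k < card F \<Longrightarrow> sorted_list_of_set G ! k < sorted_list_of_set F ! k"
proof -
  obtain \<phi> where \<phi>: "\<And>b. b \<in> F \<Longrightarrow> \<phi> b \<in> G \<and> \<phi> b < b \<and> (\<forall>z\<in>F. z < b \<longrightarrow> z < \<phi> b)"
    using gap by metis
  have inj: "inj_on \<phi> F"
  proof (rule inj_onI)
    fix x y assume "x \<in> F" "y \<in> F" "\<phi> x = \<phi> y"
    then show "x = y" using \<phi>[of x] \<phi>[of y] by (metis less_asym linorder_neqE_linordered_idom)
  qed
  show le: "card F \<le> card G"
    using \<phi> by (intro card_inj_on_le[OF inj _ assms(2)]) auto
  assume k: "k < card F"
  let ?f = "sorted_list_of_set F" and ?g = "sorted_list_of_set G"
  have len: "length ?f = card F" "length ?g = card G" and set: "set ?f = F" "set ?g = G"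
    using assms by auto
  show "?g ! k < ?f ! k"
  proof (rule ccontr)
    assume "\<not> ?thesis"
    then have ge: "?f ! k \<le> ?g ! k" by simp
    have "\<phi> ` (\<lambda>i. ?f ! i) ` {..k} \<subseteq> (\<lambda>i. ?g ! i) ` {..<k}"
    proof clarify
      fix i assume "i \<le> k"
      have fi: "?f ! i \<in> F" using \<open>i \<le> k\<close> k len set nth_mem by (metis le_less_trans)
      have "\<phi> (?f ! i) < ?f ! i" using \<phi>[OF fi] by blast
      also have "?f ! i \<le> ?f ! k"
        using \<open>i \<le> k\<close> k len by (intro sorted_nth_mono) auto
      finally have lt: "\<phi> (?f ! i) < ?g ! k" using ge by simp
      obtain j where j: "j < card G" "?g ! j = \<phi> (?f ! i)"
        using \<phi>[OF fi] set len by (metis in_set_conv_nth)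
      have "j < k"
      proof (rule ccontr)
        assume "\<not> j < k"
        then have "?g ! k \<le> ?g ! j" using j len by (intro sorted_nth_mono) auto
        with lt j show False by simp
      qed
      then show "\<phi> (?f ! i) \<in> (\<lambda>i. ?g ! i) ` {..<k}" using j by (metis imageI lessThan_iff)
    qed
    then have "card (\<phi> ` (\<lambda>i. ?f ! i) ` {..k}) \<le> card ((\<lambda>i. ?g ! i) ` {..<k})"
      by (intro card_mono) auto
    also have "\<dots> \<le> k" using card_image_le[of "{..<k}"] by simp
    finally have "card (\<phi> ` (\<lambda>i. ?f ! i) ` {..k}) \<le> k" .
    moreover have "card (\<phi> ` (\<lambda>i. ?f ! i) ` {..k}) = Suc k"
    proof -
      have "inj_on (\<lambda>i. ?f ! i) {..k}"
        using k len by (intro inj_on_nth) auto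
      moreover have "(\<lambda>i. ?f ! i) ` {..k} \<subseteq> F"
        using k len set nth_mem by (metis (no_types, lifting) atMost_iff image_subsetI le_less_trans)
      ultimately show ?thesis
        by (metis card_image inj_on_subset[OF inj] card_atMost)
    qed
    ultimately show False by simp
  qed
qed

lemma sorted_list_of_set_scale:
  fixes c :: real
  assumes "finite A" "c > 0"
  shows "sorted_list_of_set ((\<lambda>x. c * x) ` A) = map (\<lambda>x. c * x) (sorted_list_of_set A)"
proof (rule sorted_distinct_set_unique)
  show "sorted (map (\<lambda>x. c * x) (sorted_list_of_set A))"
    unfolding sorted_map
    by (rule sorted_wrt_mono_rel[OF _ sorted_sorted_list_of_set]) (use assms in auto)
  show "distinct (map (\<lambda>x. c * x) (sorted_list_of_set A))"
    using assms by (auto simp: distinct_map inj_on_def)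
qed (use assms in auto)

lemma sorted_list_of_set_initial:
  fixes G :: "real set"
  assumes "finite G" "k < card {x\<in>G. x < c}"
  shows "sorted_list_of_set {x\<in>G. x < c} ! k = sorted_list_of_set G ! k"
proof -
  have "sorted_list_of_set G = sorted_list_of_set {x\<in>G. x < c} @ sorted_list_of_set {x\<in>G. c \<le> x}"
    by (rule sorted_distinct_set_unique) (use assms in \<open>auto simp: sorted_append\<close>)
  then show ?thesis using assms by (simp add: nth_append)
qed

section \<open>Number and simplicity of the zeros\<close>

definition jacobi_roots :: "real \<Rightarrow> real \<Rightarrow> nat \<Rightarrow> real set" where
  "jacobi_roots \<alpha> \<beta> n = {x. -1 < x \<and> x < 1 \<and> poly (jacobi_sol \<alpha> \<beta> n) x = 0}"

lemma jacobi_sol_nonzero: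
  assumes "\<alpha> > -1"
  shows "jacobi_sol \<alpha> \<beta> n \<noteq> 0"
proof
  assume "jacobi_sol \<alpha> \<beta> n = 0"
  then have "pochhammer (\<alpha> + 1) n = 0"
    using jacobi_sol_at_1[of \<alpha> \<beta> n] by simp
  then show False using pochhammer_pos[of "\<alpha> + 1" n] assms by simp
qed

lemma finite_jacobi_roots:
  assumes "\<alpha> > -1"
  shows "finite (jacobi_roots \<alpha> \<beta> n)"
  by (rule finite_subset[OF _ poly_roots_finite[OF jacobi_sol_nonzero[OF assms, of \<beta> n]]])
     (auto simp: jacobi_roots_def)

text \<open>Sturm comparison in the variable \<open>x\<close>: the eigenvalue grows with the degree, and the Wronskian
vanishes at both endpoints. Including the endpoint 1 among the values of \<open>b\<close> provides
the additional zero of the polynomial of higher degree.\<close>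

lemma jacobi_roots_gap:
  assumes "\<alpha> > -1" "\<beta> > -1" and b: "b \<in> insert 1 (jacobi_roots \<alpha> \<beta> n)"
  shows "\<exists>t\<in>jacobi_roots \<alpha> \<beta> (Suc n). t < b \<and> (\<forall>z\<in>jacobi_roots \<alpha> \<beta> n. z < b \<longrightarrow> z < t)"
proof -
  let ?f = "jacobi_sol \<alpha> \<beta> n" and ?g = "jacobi_sol \<alpha> \<beta> (Suc n)"
  let ?p = "jacobi_weight (\<alpha> + 1) (\<beta> + 1)"
  have flux: "((\<lambda>x. ?p x * poly (pderiv (jacobi_sol \<alpha> \<beta> m)) x) has_real_derivative
      - (jacobi_eig \<alpha> \<beta> m * jacobi_weight \<alpha> \<beta> x) * poly (jacobi_sol \<alpha> \<beta> m) x) (at x)"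
    if "-1 < x" "x < 1" for m x
    using DERIV_jacobi_flux[OF that, of \<alpha> \<beta> "jacobi_sol \<alpha> \<beta> m"]
    by (simp add: jacobi_sol_ode[OF assms(1)] mult_ac)
  have W: "(\<lambda>x. poly ?f x * (?p x * poly (pderiv ?g) x) - poly ?g x * (?p x * poly (pderiv ?f) x))
    = (\<lambda>x. ?p x * poly (?f * pderiv ?g - ?g * pderiv ?f) x)"
    by (rule ext) (simp add: algebra_simps)
  have cont: "continuous_on UNIV (poly (?f * pderiv ?g - ?g * pderiv ?f))"
    by (intro continuous_intros)
  have "\<exists>t. -1 < t \<and> t < b \<and> poly ?g t = 0 \<and>
      (\<forall>z. -1 < z \<and> z < b \<and> poly ?f z = 0 \<longrightarrow> z < t)"
  proof (rule sturm_comparison[where p = ?p and r = 1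
        and f' = "poly (pderiv ?f)" and g' = "poly (pderiv ?g)"])
    show "?p t > 0" if "-1 < t" "t < 1" for t
      using that by (simp add: jacobi_weight_def)
    show "jacobi_eig \<alpha> \<beta> n * jacobi_weight \<alpha> \<beta> t < jacobi_eig \<alpha> \<beta> (Suc n) * jacobi_weight \<alpha> \<beta> t"
      if "-1 < t" "t < 1" for t
      using that jacobi_eig_less[OF assms(1,2), of n "Suc n"]
      by (intro mult_strict_right_mono) (auto simp: jacobi_weight_def)
    show "finite {t. -1 < t \<and> t < 1 \<and> poly ?f t = 0}"
      using finite_jacobi_roots[OF assms(1), of \<beta> n] by (simp add: jacobi_roots_def)
    show "((\<lambda>x. poly ?f x * (?p x * poly (pderiv ?g) x) - poly ?g x * (?p x * poly (pderiv ?f) x))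
        \<longlongrightarrow> 0) (at_right (-1))"
      unfolding W by (rule jacobi_weight_end_limits(2)[OF _ _ cont]) (use assms in auto)
    have "((\<lambda>x. poly ?f x * (?p x * poly (pderiv ?g) x) - poly ?g x * (?p x * poly (pderiv ?f) x))
        \<longlongrightarrow> 0) (at_left 1)"
      unfolding W by (rule jacobi_weight_end_limits(1)[OF _ _ cont]) (use assms in auto)
    then show "b < 1 \<and> poly ?f b = 0 \<or>
      b = 1 \<and> ((\<lambda>x. poly ?f x * (?p x * poly (pderiv ?g) x) - poly ?g x * (?p x * poly (pderiv ?f) x))
        \<longlongrightarrow> 0) (at_left 1)"
      using b by (auto simp: jacobi_roots_def)
  qed (use b flux in \<open>auto simp: jacobi_roots_def poly_DERIV\<close>)
  then show ?thesis using b by (auto simp: jacobi_roots_def)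
qed

text \<open>A polynomial of degree \<open>n\<close> has at most \<open>n\<close> zeros. There are at least \<open>n\<close> by induction, because
the zeros of degree \<open>n\<close> together with 1 bound \<open>n + 1\<close> gaps.\<close>

lemma card_jacobi_roots:
  assumes "\<alpha> > -1" "\<beta> > -1"
  shows "card (jacobi_roots \<alpha> \<beta> n) = n"
proof (rule antisym)
  have "card (jacobi_roots \<alpha> \<beta> n) \<le> card {x. poly (jacobi_sol \<alpha> \<beta> n) x = 0}"
    by (intro card_mono poly_roots_finite jacobi_sol_nonzero assms) (auto simp: jacobi_roots_def)
  also have "\<dots> \<le> n"
    using card_poly_roots_bound[OF jacobi_sol_nonzero[OF assms(1)], of \<beta> n] degree_jacobi_sol[OF assms, of n]
    by simp
  finally show "card (jacobi_roots \<alpha> \<beta> n) \<le> n" .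
  show "n \<le> card (jacobi_roots \<alpha> \<beta> n)"
  proof (induction n)
    case (Suc n)
    have "card (insert 1 (jacobi_roots \<alpha> \<beta> n)) \<le> card (jacobi_roots \<alpha> \<beta> (Suc n))"
    proof (rule sorted_list_of_set_gap(1))
      fix b assume b: "b \<in> insert 1 (jacobi_roots \<alpha> \<beta> n)"
      then show "\<exists>t\<in>jacobi_roots \<alpha> \<beta> (Suc n). t < b \<and>
          (\<forall>z\<in>insert 1 (jacobi_roots \<alpha> \<beta> n). z < b \<longrightarrow> z < t)"
        using jacobi_roots_gap[OF assms b] by (auto simp: jacobi_roots_def)
    qed (use finite_jacobi_roots assms in auto)
    moreover have "1 \<notin> jacobi_roots \<alpha> \<beta> n" by (simp add: jacobi_roots_def)
    ultimately show ?case using Suc finite_jacobi_roots[OF assms(1), of \<beta> n] by simp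
  qed simp
qed

text \<open>Dividing out the linear factor of a double zero would leave a polynomial of degree \<open>n - 1\<close> with the
same \<open>n\<close> zeros.\<close>

lemma jacobi_roots_simple:
  assumes "\<alpha> > -1" "\<beta> > -1" "x \<in> jacobi_roots \<alpha> \<beta> n"
  shows "poly (pderiv (jacobi_sol \<alpha> \<beta> n)) x \<noteq> 0"
proof
  assume d: "poly (pderiv (jacobi_sol \<alpha> \<beta> n)) x = 0"
  from assms(3) obtain q where q: "jacobi_sol \<alpha> \<beta> n = [:-x, 1:] * q"
    by (auto simp: jacobi_roots_def poly_eq_0_iff_dvd)
  have q0: "q \<noteq> 0" using q jacobi_sol_nonzero[OF assms(1), of \<beta> n] by auto
  have "poly (pderiv (jacobi_sol \<alpha> \<beta> n)) x = poly q x"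
    unfolding q pderiv_mult by (simp add: pderiv_pCons)
  then have "jacobi_roots \<alpha> \<beta> n \<subseteq> {z. poly q z = 0}"
    using d q by (auto simp: jacobi_roots_def)
  then have "n \<le> card {z. poly q z = 0}"
    using card_mono[OF poly_roots_finite[OF q0]] card_jacobi_roots[OF assms(1,2), of n] by metis
  also have "\<dots> \<le> degree q" by (rule card_poly_roots_bound[OF q0])
  also have "degree q < degree ([:-x, 1:] * q)"
    using q0 by (subst degree_mult_eq) auto
  also have "\<dots> = n"
    using degree_jacobi_sol[OF assms(1,2), of n] q by simp
  finally show False by simp
qed

definition jacobi_angles :: "real \<Rightarrow> real \<Rightarrow> nat \<Rightarrow> real set" where
  "jacobi_angles \<alpha> \<beta> n = {t. 0 < t \<and> t < pi \<and> poly (jacobi_sol \<alpha> \<beta> n) (cos t) = 0}"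

lemma jacobi_angles_finite_card:
  assumes "\<alpha> > -1" "\<beta> > -1"
  shows "finite (jacobi_angles \<alpha> \<beta> n)" "card (jacobi_angles \<alpha> \<beta> n) = n"
proof -
  have "bij_betw cos (jacobi_angles \<alpha> \<beta> n) (jacobi_roots \<alpha> \<beta> n)"
  proof (rule bij_betwI[where g = arccos])
    show "cos \<in> jacobi_angles \<alpha> \<beta> n \<rightarrow> jacobi_roots \<alpha> \<beta> n"
      using cos_monotone_0_pi[of 0] cos_monotone_0_pi[of _ pi]
      by (auto simp: jacobi_angles_def jacobi_roots_def)
    show "arccos \<in> jacobi_roots \<alpha> \<beta> n \<rightarrow> jacobi_angles \<alpha> \<beta> n"
      by (auto simp: jacobi_angles_def jacobi_roots_def arccos_lt_bounded)
  qed (auto simp: jacobi_angles_def jacobi_roots_def arccos_cos)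
  then show "finite (jacobi_angles \<alpha> \<beta> n)" "card (jacobi_angles \<alpha> \<beta> n) = n"
    using bij_betw_finite bij_betw_same_card finite_jacobi_roots card_jacobi_roots assms by metis+
qed

lemma jacobi_angle_eq:
  assumes "\<alpha> > -1" "\<beta> > -1"
  shows "jacobi_angle \<alpha> \<beta> n k = sorted_list_of_set (jacobi_angles \<alpha> \<beta> n) ! (k - 1)"
  by (simp add: jacobi_angle_def jacobi_angles_def jacobi_poly_eq[OF assms])

section \<open>Liouville normal form\<close>

text \<open>With \<open>x = \<theta> / 2\<close>, the factor \<open>(sin x)\<^bsup>\<alpha> + 1/2\<^esup> (cos x)\<^bsup>\<beta> + 1/2\<^esup>\<close> removes the first-order
term from the Jacobi equation. The half angle is used because both singular points then enter
through \<open>sin x\<close> and \<open>cos x\<close>, as they do in the function \<open>\<Phi>\<close> of the theorem.\<close>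

definition liouville_factor :: "real \<Rightarrow> real \<Rightarrow> real \<Rightarrow> real" where
  "liouville_factor \<alpha> \<beta> x = sin x powr (\<alpha> + 1/2) * cos x powr (\<beta> + 1/2)"

definition liouville_log_deriv :: "real \<Rightarrow> real \<Rightarrow> real \<Rightarrow> real" where
  "liouville_log_deriv \<alpha> \<beta> x =
     (\<alpha> + 1/2) * (cos x / sin x) - (\<beta> + 1/2) * (sin x / cos x)"

definition liouville :: "real \<Rightarrow> real \<Rightarrow> real poly \<Rightarrow> real \<Rightarrow> real" where
  "liouville \<alpha> \<beta> y x = liouville_factor \<alpha> \<beta> x * poly y (cos (2 * x))"

definition liouville_deriv :: "real \<Rightarrow> real \<Rightarrow> real poly \<Rightarrow> real \<Rightarrow> real" where
  "liouville_deriv \<alpha> \<beta> y x = liouville_factor \<alpha> \<beta> x *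
     (liouville_log_deriv \<alpha> \<beta> x * poly y (cos (2 * x)) -
      2 * sin (2 * x) * poly (pderiv y) (cos (2 * x)))"

text \<open>The coefficient in \<open>U'' + R U = 0\<close>; the parameter \<open>N\<close> stands for \<open>n + \<rho>\<close>.\<close>

definition liouville_potential :: "real \<Rightarrow> real \<Rightarrow> real \<Rightarrow> real \<Rightarrow> real" where
  "liouville_potential \<alpha> \<beta> N x =
     4 * N\<^sup>2 + (1/4 - \<alpha>\<^sup>2) / (sin x)\<^sup>2 + (1/4 - \<beta>\<^sup>2) / (cos x)\<^sup>2"

lemma sin_cos_pos:
  fixes x :: real
  assumes "0 < x" "x < pi/2"
  shows "sin x > 0" "cos x > 0"
  using assms by (auto intro!: sin_gt_zero cos_gt_zero)

lemma DERIV_liouville_factor: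
  assumes "0 < x" "x < pi/2"
  shows "(liouville_factor \<alpha> \<beta> has_real_derivative
    liouville_factor \<alpha> \<beta> x * liouville_log_deriv \<alpha> \<beta> x) (at x)"
proof -
  note pos = sin_cos_pos[OF assms]
  have "((\<lambda>x. sin x powr a * cos x powr b) has_real_derivative
    (sin x powr a * cos x powr b) * (a * (cos x / sin x) - b * (sin x / cos x))) (at x)" for a b
  proof (rule DERIV_cong)
    show "((\<lambda>x. sin x powr a * cos x powr b) has_real_derivative
      (a * sin x powr (a - 1) * cos x) * cos x powr b +
      (b * cos x powr (b - 1) * (- sin x)) * sin x powr a) (at x)"
      using DERIV_mult[OF DERIV_fun_powr[OF DERIV_sin pos(1), of a]
          DERIV_fun_powr[OF DERIV_cos pos(2), of b]] by simp
    have "sin x powr (a - 1) = sin x powr a / sin x" "cos x powr (b - 1) = cos x powr b / cos x"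
      using pos by (simp_all add: powr_diff)
    then show "(a * sin x powr (a - 1) * cos x) * cos x powr b +
      (b * cos x powr (b - 1) * (- sin x)) * sin x powr a =
      (sin x powr a * cos x powr b) * (a * (cos x / sin x) - b * (sin x / cos x))"
      by (simp add: algebra_simps)
  qed
  then show ?thesis
    unfolding liouville_factor_def liouville_log_deriv_def .
qed

lemma DERIV_liouville:
  assumes "0 < x" "x < pi/2"
  shows "(liouville \<alpha> \<beta> y has_real_derivative liouville_deriv \<alpha> \<beta> y x) (at x)"
proof -
  have "((\<lambda>x. poly y (cos (2 * x))) has_real_derivative
    - 2 * sin (2 * x) * poly (pderiv y) (cos (2 * x))) (at x)"
    by (rule DERIV_cong[OF DERIV_chain2[OF poly_DERIV]])
       (auto intro!: derivative_eq_intros)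
  from DERIV_mult[OF DERIV_liouville_factor[OF assms, of \<alpha> \<beta>] this]
  show ?thesis unfolding liouville_def[abs_def] liouville_deriv_def
    by (rule DERIV_cong) (simp add: algebra_simps)
qed

lemma DERIV_liouville_deriv:
  fixes \<alpha> \<beta> x :: real and n :: nat
  assumes "0 < x" "x < pi/2" "\<alpha> > -1"
  defines "y \<equiv> jacobi_sol \<alpha> \<beta> n"
  shows "(liouville_deriv \<alpha> \<beta> y has_real_derivative
     - liouville_potential \<alpha> \<beta> (real n + jacobi_rho \<alpha> \<beta>) x * liouville \<alpha> \<beta> y x) (at x)"
proof -
  note pos = sin_cos_pos[OF assms(1,2)]
  define s where "s = sin x"
  define c where "c = cos x"
  define F where "F = liouville_factor \<alpha> \<beta> x"
  define l where "l = liouville_log_deriv \<alpha> \<beta> x"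
  define z where "z = cos (2 * x)"
  define S where "S = sin (2 * x)"
  define y0 y1 y2 where "y0 = poly y z" and "y1 = poly (pderiv y) z" and "y2 = poly (pderiv (pderiv y)) z"
  define l' where "l' = - ((\<alpha> + 1/2) / s\<^sup>2) - (\<beta> + 1/2) / c\<^sup>2"
  have sc: "s > 0" "c > 0" "s\<^sup>2 + c\<^sup>2 = 1"
    using pos by (auto simp: s_def c_def)
  have z1: "2 * c\<^sup>2 = 1 + z" "2 * s\<^sup>2 = 1 - z" and S: "S = 2 * s * c" "S\<^sup>2 = 1 - z\<^sup>2"
    using sin_squared_eq[of "2 * x"]
    by (simp_all only: z_def S_def s_def c_def cos_double_cos sin_double sin_squared_eq)
       simp_all
  have dl: "(liouville_log_deriv \<alpha> \<beta> has_real_derivative l') (at x)"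
  proof -
    have k1: "((\<lambda>x. cos x / sin x) has_real_derivative - 1 / s\<^sup>2) (at x)"
      using DERIV_cot[of x] pos(1) unfolding cot_def[abs_def] s_def by (simp add: divide_inverse)
    have k2: "((\<lambda>x. sin x / cos x) has_real_derivative 1 / c\<^sup>2) (at x)"
      using DERIV_tan[of x] pos(2) unfolding tan_def[abs_def] c_def by (simp add: divide_inverse)
    show ?thesis
      unfolding liouville_log_deriv_def[abs_def] l'_def
      by (rule DERIV_cong[OF DERIV_diff[OF DERIV_cmult[OF k1] DERIV_cmult[OF k2]]])
         simp
  qed
  have dp: "((\<lambda>x. poly q (cos (2 * x))) has_real_derivative - 2 * S * poly (pderiv q) z) (at x)" for q
    unfolding S_def z_def
    by (rule DERIV_cong[OF DERIV_chain2[OF poly_DERIV]]) (auto intro!: derivative_eq_intros)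
  have dS: "((\<lambda>x. 2 * sin (2 * x)) has_real_derivative 4 * z) (at x)"
    unfolding z_def by (auto intro!: derivative_eq_intros)
  have D: "(liouville_deriv \<alpha> \<beta> y has_real_derivative
     F * l * (l * y0 - 2 * S * y1) +
     (l' * y0 + - 2 * S * y1 * l - (4 * z * y1 + - 2 * S * y2 * (2 * S))) * F) (at x)"
    unfolding liouville_deriv_def[abs_def] F_def l_def y0_def y1_def y2_def z_def S_def
    by (rule DERIV_mult[OF DERIV_liouville_factor[OF assms(1,2)]
         DERIV_diff[OF DERIV_mult[OF dl dp[unfolded z_def S_def]]
           DERIV_mult[OF dS[unfolded z_def] dp[unfolded z_def S_def]]]])
  have ode: "(1 - z\<^sup>2) * y2 + (\<beta> - \<alpha> - (\<alpha> + \<beta> + 2) * z) * y1 = - jacobi_eig \<alpha> \<beta> n * y0"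
    using arg_cong[OF jacobi_sol_ode[OF assms(3), of \<beta> n], of "\<lambda>p. poly p z"]
    unfolding y0_def y1_def y2_def y_def
    by (simp add: jacobi_op_def power2_eq_square algebra_simps)
  \<comment> \<open>The terms with the first derivative of the polynomial recombine to the Jacobi equation.\<close>
  have K1: "l * S = (\<alpha> - \<beta>) + (\<alpha> + \<beta> + 1) * z"
  proof -
    have "l * S = (\<alpha> + 1/2) * (2 * c\<^sup>2) - (\<beta> + 1/2) * (2 * s\<^sup>2)"
      using sc unfolding S l_def liouville_log_deriv_def s_def[symmetric] c_def[symmetric]
      by (simp add: field_simps power2_eq_square)
    then show ?thesis unfolding z1 by (simp add: field_simps)
  qed
  \<comment> \<open>The remaining terms are the potential, up to the eigenvalue supplied by the Jacobi equation.\<close>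
  have K2: "l\<^sup>2 + l' = 4 * jacobi_eig \<alpha> \<beta> n
      - liouville_potential \<alpha> \<beta> (real n + jacobi_rho \<alpha> \<beta>) x"
  proof -
    have i1: "(c / s)\<^sup>2 = 1 / s\<^sup>2 - 1" and i2: "(s / c)\<^sup>2 = 1 / c\<^sup>2 - 1"
      and i3: "(c / s) * (s / c) = 1"
      using sc by (auto simp: field_simps)
    have sq: "(p * u - q * v)\<^sup>2 = p\<^sup>2 * u\<^sup>2 - 2 * p * q * (u * v) + q\<^sup>2 * v\<^sup>2" for p q u v :: real
      by (simp add: power2_eq_square algebra_simps)
    have "l\<^sup>2 = (\<alpha> + 1/2)\<^sup>2 * (c / s)\<^sup>2 - 2 * (\<alpha> + 1/2) * (\<beta> + 1/2) * ((c / s) * (s / c))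
        + (\<beta> + 1/2)\<^sup>2 * (s / c)\<^sup>2"
      unfolding l_def liouville_log_deriv_def s_def[symmetric] c_def[symmetric]
      by (rule sq)
    also have "\<dots> = (\<alpha> + 1/2)\<^sup>2 * (1 / s\<^sup>2 - 1) - 2 * (\<alpha> + 1/2) * (\<beta> + 1/2)
        + (\<beta> + 1/2)\<^sup>2 * (1 / c\<^sup>2 - 1)"
      unfolding i1 i2 i3 by simp
    finally have l2: "l\<^sup>2 = \<dots>" .
    have gen: "(\<alpha> + 1/2)\<^sup>2 * (u - 1) - 2 * (\<alpha> + 1/2) * (\<beta> + 1/2) + (\<beta> + 1/2)\<^sup>2 * (v - 1)
        + (- ((\<alpha> + 1/2) * u) - (\<beta> + 1/2) * v) =
       4 * jacobi_eig \<alpha> \<beta> n - (4 * (real n + jacobi_rho \<alpha> \<beta>)\<^sup>2 + (1/4 - \<alpha>\<^sup>2) * u + (1/4 - \<beta>\<^sup>2) * v)" for u v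
      by (simp add: jacobi_eig_def jacobi_rho_def power2_eq_square field_simps)
    show ?thesis
      using gen[of "1 / s\<^sup>2" "1 / c\<^sup>2"] unfolding l2 l'_def liouville_potential_def s_def c_def
      by simp
  qed
  have "F * l * (l * y0 - 2 * S * y1) +
     (l' * y0 + - 2 * S * y1 * l - (4 * z * y1 + - 2 * S * y2 * (2 * S))) * F =
     F * ((l\<^sup>2 + l') * y0 - 4 * (l * S) * y1 - 4 * z * y1 + 4 * S\<^sup>2 * y2)"
    by (simp add: power2_eq_square algebra_simps)
  also have "\<dots> = F * ((l\<^sup>2 + l') * y0
     + 4 * ((1 - z\<^sup>2) * y2 + (\<beta> - \<alpha> - (\<alpha> + \<beta> + 2) * z) * y1))"
    unfolding K1 S(2) by (simp add: algebra_simps)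
  also have "\<dots> = - liouville_potential \<alpha> \<beta> (real n + jacobi_rho \<alpha> \<beta>) x * (F * y0)"
    unfolding ode K2 by (simp add: algebra_simps)
  finally show ?thesis
    using D unfolding liouville_def F_def y0_def z_def by simp
qed

text \<open>The pole of \<open>c cot (c t)\<close> at 0 has the same residue for every \<open>c\<close>, so the difference of two such
functions is of order \<open>t\<close>.\<close>

lemma tendsto_cot_difference:
  assumes "c > (0::real)"
  shows "((\<lambda>t. (c * (cos (c * t) / sin (c * t)) - 1 / t) / t) \<longlongrightarrow> - (c\<^sup>2 / 3)) (at_right 0)"
  using assms by real_asymp (simp add: field_simps power2_eq_square)

lemma tendsto_sin_over:
  fixes c :: real
  shows "((\<lambda>t. sin (c * t) / t) \<longlongrightarrow> c) (at_right 0)"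
  by real_asymp

text \<open>Both functions have the exponent \<open>\<alpha> + 1/2\<close> at 0. The product
of their prefactors is of order \<open>t\<^bsup>2\<alpha> + 1\<^esup>\<close>, which may be unbounded, but the bracket that it
multiplies is of order \<open>t\<close>: the poles of the two logarithmic derivatives cancel, and the
polynomial factors are even in \<open>t\<close>, so that their derivatives are of order \<open>t\<close>. The total order
\<open>2\<alpha> + 2\<close> is positive.\<close>

lemma liouville_wronskian_tendsto:
  assumes "\<alpha> > -1" "c > 0" "d > 0"
  shows "((\<lambda>t. liouville \<alpha> \<beta> y (c * t) * (d * liouville_deriv \<alpha> \<beta> w (d * t)) -
     liouville \<alpha> \<beta> w (d * t) * (c * liouville_deriv \<alpha> \<beta> y (c * t))) \<longlongrightarrow> 0) (at_right 0)"
proof -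
  define a b where "a = \<alpha> + 1/2" and "b = \<beta> + 1/2"
  \<comment> \<open>The Wronskian is \<open>A t * B t\<close>: \<open>B\<close> is the bracket divided by \<open>t\<close>, and \<open>A\<close> is \<open>t\<close> times the product of the prefactors.\<close>
  define B where "B t = poly y (cos (2 * (c * t))) * poly w (cos (2 * (d * t))) *
     (a * ((d * (cos (d * t) / sin (d * t)) - 1 / t) / t - (c * (cos (c * t) / sin (c * t)) - 1 / t) / t)
      - b * (d * (sin (d * t) / t / cos (d * t)) - c * (sin (c * t) / t / cos (c * t))))
    - poly y (cos (2 * (c * t))) * d * 2 * (sin ((2 * d) * t) / t) * poly (pderiv w) (cos (2 * (d * t)))
    + poly w (cos (2 * (d * t))) * c * 2 * (sin ((2 * c) * t) / t) * poly (pderiv y) (cos (2 * (c * t)))" for t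
  define A where "A t = t powr (2 * \<alpha> + 2) * ((sin (c * t) / t) powr a * (sin (d * t) / t) powr a
     * (cos (c * t) powr b * cos (d * t) powr b))" for t
  have cosl: "((\<lambda>t. cos (e * t)) \<longlongrightarrow> 1) (at_right 0)" for e :: real
    by (auto intro!: tendsto_eq_intros)
  have cosl2: "((\<lambda>t. cos (2 * (e * t))) \<longlongrightarrow> 1) (at_right 0)" for e :: real
    by (auto intro!: tendsto_eq_intros)
  have pl: "((\<lambda>t. poly q (cos (2 * (e * t)))) \<longlongrightarrow> poly q 1) (at_right 0)" for e :: real and q
    by (rule tendsto_poly[OF cosl2])
  have "\<exists>L. (B \<longlongrightarrow> L) (at_right 0)"
    unfolding B_def
    by (rule exI, (rule tendsto_intros pl tendsto_sin_over tendsto_cot_difference cosl assms | simp)+)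
  then obtain L where L: "(B \<longlongrightarrow> L) (at_right 0)" ..
  have "((\<lambda>t. t powr (2 * \<alpha> + 2)) \<longlongrightarrow> 0) (at_right (0::real))"
    by (rule tendsto_powr_0_at) (use assms in \<open>auto intro!: tendsto_eq_intros simp: eventually_at_filter\<close>)
  moreover have "((\<lambda>t. (sin (c * t) / t) powr a * (sin (d * t) / t) powr a
     * (cos (c * t) powr b * cos (d * t) powr b)) \<longlongrightarrow> c powr a * d powr a * (1 powr b * 1 powr b)) (at_right 0)"
    by (intro tendsto_intros tendsto_sin_over cosl) (use assms in auto)
  ultimately have "(A \<longlongrightarrow> 0) (at_right 0)"
    unfolding A_def using tendsto_mult by fastforce
  from tendsto_mult[OF this L] have lim: "((\<lambda>t. A t * B t) \<longlongrightarrow> 0) (at_right 0)" by simp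
  define e where "e = min (pi / (2 * c)) (pi / (2 * d))"
  have e: "e > 0" using assms by (simp add: e_def)
  have ev: "\<forall>\<^sub>F t in at_right 0. A t * B t =
     liouville \<alpha> \<beta> y (c * t) * (d * liouville_deriv \<alpha> \<beta> w (d * t)) -
     liouville \<alpha> \<beta> w (d * t) * (c * liouville_deriv \<alpha> \<beta> y (c * t))"
  proof (rule eventually_mono[OF eventually_at_right_real[OF e]])
    fix t assume t: "t \<in> {0<..<e}"
    then have t': "c * t < pi/2" "d * t < pi/2" "t > 0"
      using assms by (auto simp: e_def field_simps)
    have pos: "sin (c * t) > 0" "sin (d * t) > 0" "cos (c * t) > 0" "cos (d * t) > 0"
      using t' assms by (auto intro!: sin_cos_pos)
    have As: "A t = t * (liouville_factor \<alpha> \<beta> (c * t) * liouville_factor \<alpha> \<beta> (d * t))"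
    proof -
      have "t powr (2 * \<alpha> + 2) = t * (t powr a * t powr a)"
      proof -
        have "2 * \<alpha> + 2 = 1 + a + a" by (simp add: a_def)
        then have "t powr (2 * \<alpha> + 2) = t powr 1 * t powr a * t powr a" by (simp only: powr_add)
        then show ?thesis using t' by simp
      qed
      then show ?thesis
        using t' pos unfolding A_def liouville_factor_def a_def[symmetric] b_def[symmetric]
        by (simp add: powr_divide)
    qed
    define Cc Cd Sc Sd where "Cc = cos (c * t)" and "Cd = cos (d * t)" and "Sc = sin (c * t)" and "Sd = sin (d * t)"
    define y0 y1 w0 w1 S1 S2 where "y0 = poly y (cos (2 * (c * t)))" and "y1 = poly (pderiv y) (cos (2 * (c * t)))"
      and "w0 = poly w (cos (2 * (d * t)))" and "w1 = poly (pderiv w) (cos (2 * (d * t)))"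
      and "S1 = sin ((2 * c) * t)" and "S2 = sin ((2 * d) * t)"
    have tB: "t * B t = y0 * w0 * (d * (a * (Cd / Sd) - b * (Sd / Cd)) - c * (a * (Cc / Sc) - b * (Sc / Cc)))
       - 2 * d * y0 * S2 * w1 + 2 * c * w0 * S1 * y1"
      unfolding B_def Cc_def[symmetric] Cd_def[symmetric] Sc_def[symmetric] Sd_def[symmetric]
        y0_def[symmetric] y1_def[symmetric] w0_def[symmetric] w1_def[symmetric]
        S1_def[symmetric] S2_def[symmetric]
      using t'(3) by (simp add: ring_distribs diff_divide_distrib add_divide_distrib)
         (simp add: algebra_simps)
    have "A t * B t = (liouville_factor \<alpha> \<beta> (c * t) * liouville_factor \<alpha> \<beta> (d * t)) * (t * B t)"
      unfolding As by (simp only: mult_ac)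
    then show "A t * B t = liouville \<alpha> \<beta> y (c * t) * (d * liouville_deriv \<alpha> \<beta> w (d * t)) -
      liouville \<alpha> \<beta> w (d * t) * (c * liouville_deriv \<alpha> \<beta> y (c * t))"
      unfolding tB
      unfolding liouville_def liouville_deriv_def liouville_log_deriv_def
        a_def[symmetric] b_def[symmetric]
        Cc_def[symmetric] Cd_def[symmetric] Sc_def[symmetric] Sd_def[symmetric]
        y0_def[symmetric] y1_def[symmetric] w0_def[symmetric] w1_def[symmetric]
      by (simp add: S1_def S2_def algebra_simps)
  qed
  show ?thesis by (rule Lim_transform_eventually[OF lim ev])
qed

section \<open>The function governing the scaled potential\<close>

lemma mult_cos_less_sin:
  assumes "0 < x" "x \<le> pi/2"
  shows "x * cos x < sin (x::real)"
proof -
  have "sin 0 - 0 * cos 0 < sin x - x * cos x"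
  proof (rule DERIV_pos_imp_increasing_open[OF assms(1)])
    fix t :: real assume t: "0 < t" "t < x"
    have "((\<lambda>x. sin x - x * cos x) has_real_derivative t * sin t) (at t)"
      by (auto intro!: derivative_eq_intros)
    moreover have "t * sin t > 0" using t assms by (intro mult_pos_pos sin_gt_zero) auto
    ultimately show "\<exists>y. ((\<lambda>x. sin x - x * cos x) has_real_derivative y) (at t) \<and> 0 < y" by blast
  qed (auto intro!: continuous_intros)
  then show ?thesis by simp
qed

lemma jacobi_Phi_sin_cos:
  assumes "0 < x" "x < pi/2"
  shows "jacobi_Phi \<alpha> \<beta> x =
    (1 - 4 * \<alpha>\<^sup>2) / 16 * ((sin x - x * cos x) / sin x ^ 3) +
    (1 - 4 * \<beta>\<^sup>2) / 16 * ((cos x + x * sin x) / cos x ^ 3)"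
proof -
  have "sin x > 0" "cos x > 0" using assms by (auto intro!: sin_gt_zero cos_gt_zero)
  then show ?thesis
    by (simp add: jacobi_Phi_def cot_def tan_def field_simps power2_eq_square power3_eq_cube)
qed

text \<open>At 0 the two kernels have the ratio 1 : 3. Multiplied out in terms of \<open>T = tan x\<close>, the claim is that
\<open>T\<^sup>3 + x T\<^sup>4 - 3 T + 3 x\<close> is positive; its derivative is \<open>4 T\<^sup>4 + 4 x T\<^sup>3 (1 + T\<^sup>2)\<close>.\<close>

lemma Phi_kernels_less:
  assumes "0 < x" "x < pi/2"
  shows "3 * ((sin x - x * cos x) / sin x ^ 3) < (cos x + x * sin x) / cos (x::real) ^ 3"
proof -
  have pos: "sin x > 0" "cos x > 0" using assms by (auto intro!: sin_gt_zero cos_gt_zero)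
  define h where "h t = tan t ^ 3 + t * tan t ^ 4 - 3 * tan t + 3 * t" for t :: real
  have "h 0 < h x"
  proof (rule DERIV_pos_imp_increasing_open[OF assms(1)])
    fix t :: real assume t: "0 < t" "t < x"
    have c: "cos t > 0" and T: "tan t > 0" using t assms by (auto intro!: cos_gt_zero tan_gt_zero)
    have D: "(tan has_real_derivative 1 + tan t ^ 2) (at t)"
      using DERIV_tan[of t] c by (simp add: tan_sec power_inverse)
    have "(h has_real_derivative 4 * tan t ^ 4 + 4 * t * tan t ^ 3 * (1 + tan t ^ 2)) (at t)"
      unfolding h_def
      by (rule derivative_eq_intros D refl)+ (simp add: algebra_simps power2_eq_square power3_eq_cube power4_eq_xxxx)
    moreover have "4 * tan t ^ 4 + 4 * t * tan t ^ 3 * (1 + tan t ^ 2) > 0"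
      using T t by (intro add_pos_pos mult_pos_pos zero_less_power) auto
    ultimately show "\<exists>y. (h has_real_derivative y) (at t) \<and> 0 < y" by blast
  next
    have "cos t \<noteq> 0" if "t \<in> {0..x}" for t using that assms cos_gt_zero_pi[of t] by auto
    then show "continuous_on {0..x} h"
      unfolding h_def by (intro continuous_intros) auto
  qed
  then have "3 * (tan x - x) < (1 + x * tan x) * tan x ^ 3"
    by (simp add: h_def algebra_simps power3_eq_cube power4_eq_xxxx)
  then have "3 * (tan x - x) * cos x ^ 4 < (1 + x * tan x) * tan x ^ 3 * cos x ^ 4"
    using pos by (intro mult_strict_right_mono) auto
  moreover have sinx: "sin x = tan x * cos x" using pos by (simp add: tan_def)
  ultimately have "3 * (sin x - x * cos x) * cos x ^ 3 < (cos x + x * sin x) * sin x ^ 3"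
    unfolding sinx by (simp add: algebra_simps power3_eq_cube power4_eq_xxxx)
  then show ?thesis using pos by (simp add: field_simps)
qed

lemma Phi_sin_kernel_bounds:
  assumes "0 < x" "x < pi/2"
  shows "0 < (sin x - x * cos x) / sin x ^ 3" "(sin x - x * cos x) / sin (x::real) ^ 3 \<le> 1"
proof -
  have pos: "sin x > 0" "cos x > 0" using assms by (auto intro!: sin_gt_zero cos_gt_zero)
  show "0 < (sin x - x * cos x) / sin x ^ 3"
    using mult_cos_less_sin[of x] assms pos by auto
  have "sin x * cos x \<le> x * 1"
    using pos sin_x_le_x[of x] assms by (intro mult_mono) auto
  then have "sin x * cos x * cos x \<le> x * cos x"
    using pos by (intro mult_right_mono) auto
  moreover have "sin x ^ 3 = sin x - sin x * cos x * cos x"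
  proof -
    have "sin x ^ 3 = sin x * (sin x)\<^sup>2" by (simp add: power3_eq_cube power2_eq_square)
    also have "\<dots> = sin x - sin x * cos x * cos x"
      unfolding sin_squared_eq by (simp add: power2_eq_square algebra_simps)
    finally show ?thesis .
  qed
  ultimately have "sin x - x * cos x \<le> sin x ^ 3" by linarith
  then show "(sin x - x * cos x) / sin x ^ 3 \<le> 1"
    using pos by simp
qed

text \<open>The kernel of the first term is bounded. That of the second term is unbounded at \<open>\<pi>/2\<close>, but
\<open>|\<beta>| \<ge> 1/2\<close> makes its coefficient nonpositive.\<close>

lemma bdd_above_jacobi_Phi:
  assumes "\<bar>\<beta>\<bar> \<ge> 1/2"
  shows "bdd_above (jacobi_Phi \<alpha> \<beta> ` {0<..<pi/2})"
proof (rule bdd_aboveI2)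
  fix x :: real assume "x \<in> {0<..<pi/2}"
  then have x: "0 < x" "x < pi/2" by auto
  have pos: "sin x > 0" "cos x > 0" using x by (auto intro!: sin_gt_zero cos_gt_zero)
  have "(1/2)\<^sup>2 \<le> \<bar>\<beta>\<bar>\<^sup>2" using assms by (intro power_mono) auto
  then have B: "(1 - 4 * \<beta>\<^sup>2) / 16 \<le> 0" by (simp add: power2_eq_square)
  have "(1 - 4 * \<beta>\<^sup>2) / 16 * ((cos x + x * sin x) / cos x ^ 3) \<le> 0"
    using B pos x by (intro mult_nonpos_nonneg divide_nonneg_nonneg add_nonneg_nonneg mult_nonneg_nonneg) auto
  moreover have "(1 - 4 * \<alpha>\<^sup>2) / 16 * ((sin x - x * cos x) / sin x ^ 3) \<le>
      \<bar>(1 - 4 * \<alpha>\<^sup>2) / 16\<bar> * 1"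
    using Phi_sin_kernel_bounds[OF x] by (intro mult_mono abs_ge_self) auto
  ultimately show "jacobi_Phi \<alpha> \<beta> x \<le> \<bar>(1 - 4 * \<alpha>\<^sup>2) / 16\<bar>"
    unfolding jacobi_Phi_sin_cos[OF x] by linarith
qed

lemma jacobi_Phi_at_0:
  "(jacobi_Phi \<alpha> \<beta> \<longlongrightarrow> ((1 - 4 * \<alpha>\<^sup>2) / 3 + (1 - 4 * \<beta>\<^sup>2)) / 16) (at_right 0)"
proof -
  have k1: "((\<lambda>x. (sin x - x * cos x) / sin x ^ 3) \<longlongrightarrow> 1/3) (at_right (0::real))"
    by real_asymp
  have k2: "((\<lambda>x. (cos x + x * sin x) / cos x ^ 3) \<longlongrightarrow> 1) (at_right (0::real))"
    by real_asymp
  have "((\<lambda>x. (1 - 4 * \<alpha>\<^sup>2) / 16 * ((sin x - x * cos x) / sin x ^ 3) +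
    (1 - 4 * \<beta>\<^sup>2) / 16 * ((cos x + x * sin x) / cos x ^ 3)) \<longlongrightarrow>
    (1 - 4 * \<alpha>\<^sup>2) / 16 * (1/3) + (1 - 4 * \<beta>\<^sup>2) / 16 * 1) (at_right 0)"
    by (intro tendsto_intros k1 k2)
  moreover have "\<forall>\<^sub>F x in at_right 0. (1 - 4 * \<alpha>\<^sup>2) / 16 * ((sin x - x * cos x) / sin x ^ 3) +
    (1 - 4 * \<beta>\<^sup>2) / 16 * ((cos x + x * sin x) / cos x ^ 3) = jacobi_Phi \<alpha> \<beta> x"
    by (rule eventually_mono[OF eventually_at_right_real[of 0 "pi/2"]])
       (auto simp: jacobi_Phi_sin_cos)
  ultimately show ?thesis
    using Lim_transform_eventually by (fastforce simp: add_divide_distrib)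
qed

lemma jacobi_Phi_le_M:
  assumes "\<bar>\<beta>\<bar> \<ge> 1/2" "0 < x" "x < pi/2"
  shows "jacobi_Phi \<alpha> \<beta> x \<le> jacobi_M \<alpha> \<beta>"
  unfolding jacobi_M_def
  by (rule cSUP_upper[OF _ bdd_above_jacobi_Phi[OF assms(1)]]) (use assms in auto)

text \<open>Strictness in the case \<open>M \<le> 0\<close>. Write \<open>\<Phi> = A f + B g\<close> with \<open>B \<le> 0\<close>. The limit of \<open>\<Phi>\<close> at 0 is \<open>A/3 + B\<close>,
hence \<open>A + 3 B \<le> 0\<close>. If \<open>B < 0\<close>, then \<open>g > 3 f\<close> gives \<open>\<Phi> < (A + 3 B) f \<le> 0\<close>; if \<open>B = 0\<close>,
then \<open>A\<close> is negative. So \<open>\<Phi>\<close> can vanish somewhere only if \<open>A = B = 0\<close>.\<close>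

lemma jacobi_Phi_neg:
  assumes "\<bar>\<beta>\<bar> \<ge> 1/2" "jacobi_M \<alpha> \<beta> \<le> 0" "\<bar>\<alpha>\<bar> \<noteq> 1/2 \<or> \<bar>\<beta>\<bar> \<noteq> 1/2"
    and x: "0 < x" "x < pi/2"
  shows "jacobi_Phi \<alpha> \<beta> x < 0"
proof -
  define A B where "A = (1 - 4 * \<alpha>\<^sup>2) / 16" and "B = (1 - 4 * \<beta>\<^sup>2) / 16"
  define f g where "f = (sin x - x * cos x) / sin x ^ 3" and "g = (cos x + x * sin x) / cos x ^ 3"
  have f: "0 < f" and fg: "3 * f < g"
    using Phi_sin_kernel_bounds[OF x] Phi_kernels_less[OF x] by (auto simp: f_def g_def)
  have Phi: "jacobi_Phi \<alpha> \<beta> x = A * f + B * g"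
    unfolding jacobi_Phi_sin_cos[OF x] A_def B_def f_def g_def ..
  have sq: "(1 - 4 * u\<^sup>2) / 16 = (1/2 - \<bar>u\<bar>) * (1/2 + \<bar>u\<bar>) / 4" for u :: real
    by (simp add: field_simps power2_eq_square flip: abs_mult)
  have AB: "A \<noteq> 0 \<or> B \<noteq> 0" using assms(3) unfolding A_def B_def sq by auto
  have B: "B \<le> 0" using assms(1) unfolding B_def sq by (auto simp: mult_le_0_iff)
  have "((1 - 4 * \<alpha>\<^sup>2) / 3 + (1 - 4 * \<beta>\<^sup>2)) / 16 \<le> jacobi_M \<alpha> \<beta>"
    by (rule tendsto_upperbound[OF jacobi_Phi_at_0[of \<alpha> \<beta>]])
       (auto intro!: eventually_mono[OF eventually_at_right_real[of 0 "pi/2"]] jacobi_Phi_le_M assms)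
  then have lim: "A + 3 * B \<le> 0"
    using assms(2) unfolding A_def B_def by (simp add: field_simps)
  show ?thesis
  proof (cases "B = 0")
    case True
    then have "A < 0" using AB lim by auto
    then show ?thesis using f True by (simp add: Phi mult_neg_pos)
  next
    case False
    then have "B < 0" using B by simp
    then have "B * g < B * (3 * f)" using fg by simp
    then have "A * f + B * g < (A + 3 * B) * f" by (simp add: algebra_simps)
    also have "\<dots> \<le> 0" using f lim by (simp add: mult_nonpos_nonneg)
    finally show ?thesis by (simp add: Phi)
  qed
qed

section \<open>Rescaled zeros of consecutive degrees\<close>

text \<open>The coefficient of the equation satisfied by \<open>s \<mapsto> U(s / \<nu>)\<close>, where \<open>\<nu> = n + \<sigma>\<close> and \<open>\<tau> = \<sigma> - \<rho>\<close>, so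
that \<open>\<nu> - \<tau> = n + \<rho>\<close>. Nothing in it refers to \<open>n\<close> any more, and \<open>\<nu>\<close> may be treated as a continuous
variable.\<close>

definition scaled_potential :: "real \<Rightarrow> real \<Rightarrow> real \<Rightarrow> real \<Rightarrow> real \<Rightarrow> real" where
  "scaled_potential \<alpha> \<beta> \<tau> s \<nu> = liouville_potential \<alpha> \<beta> (\<nu> - \<tau>) (s / \<nu>) / \<nu>\<^sup>2"

text \<open>The origin of \<open>\<Phi>\<close>: it is, up to a negative factor, the part of the derivative with respect to \<open>\<nu>\<close> that
comes from the singular terms \<open>1 / (\<nu> sin (s/\<nu>))\<^sup>2\<close> and \<open>1 / (\<nu> cos (s/\<nu>))\<^sup>2\<close>.\<close>

lemma DERIV_scaled_potential:
  assumes "\<nu> > 0" "0 < s" "s < \<nu> * (pi/2)"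
  shows "(scaled_potential \<alpha> \<beta> \<tau> s has_real_derivative
    8 / \<nu> ^ 3 * (\<tau> * (\<nu> - \<tau>) - jacobi_Phi \<alpha> \<beta> (s / \<nu>))) (at \<nu>)"
proof -
  define x where "x = s / \<nu>"
  have x: "0 < x" "x < pi/2" using assms by (auto simp: x_def field_simps)
  note pos = sin_cos_pos[OF x]
  define A B where "A = 1/4 - \<alpha>\<^sup>2" and "B = 1/4 - \<beta>\<^sup>2"
  define u v where "u = \<nu> * sin x" and "v = \<nu> * cos x"
  have uv: "u > 0" "v > 0" using pos assms by (auto simp: u_def v_def)
  have dx: "((\<lambda>\<nu>. s / \<nu>) has_real_derivative - x / \<nu>) (at \<nu>)"
    using assms by (auto intro!: derivative_eq_intros simp: x_def power2_eq_square)
  have d1: "((\<lambda>\<nu>. \<nu> * sin (s / \<nu>)) has_real_derivative sin x - x * cos x) (at \<nu>)"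
    by (rule DERIV_cong[OF DERIV_mult[OF DERIV_ident DERIV_fun_sin[OF dx]]])
       (use assms in \<open>simp add: x_def[symmetric]\<close>)
  have d2: "((\<lambda>\<nu>. \<nu> * cos (s / \<nu>)) has_real_derivative cos x + x * sin x) (at \<nu>)"
    by (rule DERIV_cong[OF DERIV_mult[OF DERIV_ident DERIV_fun_cos[OF dx]]])
       (use assms in \<open>simp add: x_def[symmetric]\<close>)
  have inv2: "((\<lambda>\<nu>. K / (h \<nu>)\<^sup>2) has_real_derivative - (2 * K * h' / h \<nu> ^ 3)) (at \<nu>)"
    if "(h has_real_derivative h') (at \<nu>)" "h \<nu> \<noteq> 0" for K h h'
    by (rule derivative_eq_intros that refl | simp add: that)+
       (use that in \<open>simp add: field_simps power2_eq_square power3_eq_cube power4_eq_xxxx\<close>)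
  have d3: "((\<lambda>\<nu>. 4 * ((\<nu> - \<tau>) / \<nu>)\<^sup>2) has_real_derivative 8 * \<tau> * (\<nu> - \<tau>) / \<nu> ^ 3) (at \<nu>)"
    using assms by (auto intro!: derivative_eq_intros simp: field_simps power2_eq_square power3_eq_cube)
  have fn: "scaled_potential \<alpha> \<beta> \<tau> s = (\<lambda>\<nu>. 4 * ((\<nu> - \<tau>) / \<nu>)\<^sup>2 + A / (\<nu> * sin (s / \<nu>))\<^sup>2
      + B / (\<nu> * cos (s / \<nu>))\<^sup>2)"
    by (rule ext) (simp add: scaled_potential_def liouville_potential_def A_def B_def
        add_divide_distrib power_divide power_mult_distrib mult.commute)
  have "(scaled_potential \<alpha> \<beta> \<tau> s has_real_derivative
      8 * \<tau> * (\<nu> - \<tau>) / \<nu> ^ 3 + - (2 * A * (sin x - x * cos x) / u ^ 3)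
      + - (2 * B * (cos x + x * sin x) / v ^ 3)) (at \<nu>)"
    unfolding fn u_def v_def x_def
    by (intro DERIV_add d3 inv2 d1[unfolded x_def] d2[unfolded x_def])
       (use uv in \<open>auto simp: u_def v_def x_def\<close>)
  moreover have "8 * \<tau> * (\<nu> - \<tau>) / \<nu> ^ 3 + - (2 * A * (sin x - x * cos x) / u ^ 3)
      + - (2 * B * (cos x + x * sin x) / v ^ 3) =
      8 / \<nu> ^ 3 * (\<tau> * (\<nu> - \<tau>) - jacobi_Phi \<alpha> \<beta> x)"
  proof -
    have AB: "2 * A = 8 * ((1 - 4 * \<alpha>\<^sup>2) / 16)" "2 * B = 8 * ((1 - 4 * \<beta>\<^sup>2) / 16)"
      by (simp_all add: A_def B_def)
    have "8 * \<tau> * (\<nu> - \<tau>) / N + - (8 * P * k / (N * S)) + - (8 * Q * m / (N * C)) =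
        8 / N * (\<tau> * (\<nu> - \<tau>) - (P * (k / S) + Q * (m / C)))" for N P Q k m S C :: real
      by (simp add: algebra_simps diff_divide_distrib)
    then show ?thesis
      unfolding jacobi_Phi_sin_cos[OF x] u_def v_def power_mult_distrib AB .
  qed
  ultimately show ?thesis by (simp add: x_def)
qed

lemma scaled_potential_less:
  assumes "0 < \<nu>" "\<nu> < \<mu>" "0 < s" "s < \<nu> * (pi/2)"
    and Phi: "\<And>x \<kappa>. 0 < x \<Longrightarrow> x < pi/2 \<Longrightarrow> \<nu> < \<kappa> \<Longrightarrow> jacobi_Phi \<alpha> \<beta> x < \<tau> * (\<kappa> - \<tau>)"
  shows "scaled_potential \<alpha> \<beta> \<tau> s \<nu> < scaled_potential \<alpha> \<beta> \<tau> s \<mu>"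
proof (rule DERIV_pos_imp_increasing_open[OF assms(2)])
  have bd: "s < \<kappa> * (pi/2)" if "\<nu> \<le> \<kappa>" for \<kappa>
    by (rule less_le_trans[OF assms(4) mult_right_mono[OF that]]) simp
  fix \<kappa> assume \<kappa>: "\<nu> < \<kappa>" "\<kappa> < \<mu>"
  have "0 < s / \<kappa>" "s / \<kappa> < pi/2" using \<kappa> assms bd[of \<kappa>] by (auto simp: field_simps)
  from Phi[OF this \<kappa>(1)] have "0 < 8 / \<kappa> ^ 3 * (\<tau> * (\<kappa> - \<tau>) - jacobi_Phi \<alpha> \<beta> (s / \<kappa>))"
    using \<kappa> assms by (intro mult_pos_pos) auto
  then show "\<exists>y. (scaled_potential \<alpha> \<beta> \<tau> s has_real_derivative y) (at \<kappa>) \<and> 0 < y"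
    using DERIV_scaled_potential[of \<kappa> s \<alpha> \<beta> \<tau>] \<kappa> assms bd[of \<kappa>] by (metis less_trans less_imp_le)
next
  have bd: "s < \<kappa> * (pi/2)" if "\<nu> \<le> \<kappa>" for \<kappa>
    by (rule less_le_trans[OF assms(4) mult_right_mono[OF that]]) simp
  show "continuous_on {\<nu>..\<mu>} (scaled_potential \<alpha> \<beta> \<tau> s)"
    by (intro continuous_at_imp_continuous_on ballI DERIV_isCont[OF DERIV_scaled_potential] bd)
       (use assms in auto)
qed

text \<open>The numbers \<open>\<nu> \<theta> / 2\<close> for the angles \<open>\<theta>\<close> of the zeros, as zeros of the rescaled solution.\<close>

definition scaled_zeros :: "real \<Rightarrow> real \<Rightarrow> nat \<Rightarrow> real \<Rightarrow> real set" where
  "scaled_zeros \<alpha> \<beta> n \<nu> = {s. 0 < s \<and> s < \<nu> * (pi/2) \<and> liouville \<alpha> \<beta> (jacobi_sol \<alpha> \<beta> n) (s / \<nu>) = 0}"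

lemma scaled_zeros_eq:
  assumes "\<nu> > 0"
  shows "scaled_zeros \<alpha> \<beta> n \<nu> = (\<lambda>\<theta>. \<nu> / 2 * \<theta>) ` jacobi_angles \<alpha> \<beta> n"
proof -
  have "s \<in> scaled_zeros \<alpha> \<beta> n \<nu> \<longleftrightarrow> 2 * s / \<nu> \<in> jacobi_angles \<alpha> \<beta> n" for s
  proof (cases "0 < s \<and> s < \<nu> * (pi/2)")
    case True
    then have "0 < s / \<nu>" "s / \<nu> < pi/2" using assms by (auto simp: field_simps)
    from sin_cos_pos[OF this] have "liouville_factor \<alpha> \<beta> (s / \<nu>) \<noteq> 0"
      by (simp add: liouville_factor_def)
    then show ?thesis
      using True assms by (simp add: scaled_zeros_def jacobi_angles_def liouville_def field_simps)
  next
    case False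
    then show ?thesis using assms by (auto simp: scaled_zeros_def jacobi_angles_def field_simps)
  qed
  then have "scaled_zeros \<alpha> \<beta> n \<nu> = {s. 2 * s / \<nu> \<in> jacobi_angles \<alpha> \<beta> n}" by blast
  also have "\<dots> = (\<lambda>\<theta>. \<nu> / 2 * \<theta>) ` jacobi_angles \<alpha> \<beta> n"
  proof (intro set_eqI iffI)
    fix s assume "s \<in> {s. 2 * s / \<nu> \<in> jacobi_angles \<alpha> \<beta> n}"
    then show "s \<in> (\<lambda>\<theta>. \<nu> / 2 * \<theta>) ` jacobi_angles \<alpha> \<beta> n"
      using assms by (intro image_eqI[of _ _ "2 * s / \<nu>"]) auto
  qed (use assms in auto)
  finally show ?thesis .
qed

lemma scaled_zeros_finite_card:
  assumes "\<alpha> > -1" "\<beta> > -1" "\<nu> > 0"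
  shows "finite (scaled_zeros \<alpha> \<beta> n \<nu>)" "card (scaled_zeros \<alpha> \<beta> n \<nu>) = n"
  using jacobi_angles_finite_card[OF assms(1,2), of n] assms(3)
  by (auto simp: scaled_zeros_eq card_image inj_on_def)

lemma scaled_zeros_nth:
  assumes "\<alpha> > -1" "\<beta> > -1" "\<nu> > 0" "1 \<le> k" "k \<le> n"
  shows "sorted_list_of_set (scaled_zeros \<alpha> \<beta> n \<nu>) ! (k - 1) = \<nu> / 2 * jacobi_angle \<alpha> \<beta> n k"
proof -
  note ang = jacobi_angles_finite_card[OF assms(1,2), of n]
  have "sorted_list_of_set (scaled_zeros \<alpha> \<beta> n \<nu>)
      = map (\<lambda>\<theta>. \<nu> / 2 * \<theta>) (sorted_list_of_set (jacobi_angles \<alpha> \<beta> n))"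
    unfolding scaled_zeros_eq[OF assms(3)] using assms(3) ang(1)
    by (intro sorted_list_of_set_scale) auto
  then show ?thesis using ang assms(4,5) by (simp add: jacobi_angle_eq[OF assms(1,2)])
qed

lemma DERIV_scaled_liouville:
  assumes "\<nu> > 0" "0 < s" "s < \<nu> * (pi/2)"
  shows "((\<lambda>s. liouville \<alpha> \<beta> y (s / \<nu>)) has_real_derivative liouville_deriv \<alpha> \<beta> y (s / \<nu>) / \<nu>) (at s)"
proof -
  have "0 < s / \<nu>" "s / \<nu> < pi/2" using assms by (auto simp: field_simps)
  from DERIV_chain2[OF DERIV_liouville[OF this] DERIV_cdivide[OF DERIV_ident]]
  show ?thesis by simp
qed

lemma DERIV_scaled_liouville_deriv:
  assumes "\<nu> > 0" "0 < s" "s < \<nu> * (pi/2)" "\<alpha> > -1"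
    and "\<nu> - \<tau> = real n + jacobi_rho \<alpha> \<beta>"
  shows "((\<lambda>s. 1 * (liouville_deriv \<alpha> \<beta> (jacobi_sol \<alpha> \<beta> n) (s / \<nu>) / \<nu>)) has_real_derivative
    - scaled_potential \<alpha> \<beta> \<tau> s \<nu> * liouville \<alpha> \<beta> (jacobi_sol \<alpha> \<beta> n) (s / \<nu>)) (at s)"
proof -
  have "0 < s / \<nu>" "s / \<nu> < pi/2" using assms by (auto simp: field_simps)
  from DERIV_cdivide[OF DERIV_chain2[OF DERIV_liouville_deriv[OF this assms(4), of \<beta> n]
      DERIV_cdivide[OF DERIV_ident]], of \<nu>]
  show ?thesis
    by (simp add: scaled_potential_def assms(5) power2_eq_square)
qed

lemma scaled_wronskian_tendsto:
  assumes "\<alpha> > -1" "\<nu> > 0" "\<mu> > 0"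
  shows "((\<lambda>s. liouville \<alpha> \<beta> y (s / \<nu>) * (1 * (liouville_deriv \<alpha> \<beta> w (s / \<mu>) / \<mu>)) -
     liouville \<alpha> \<beta> w (s / \<mu>) * (1 * (liouville_deriv \<alpha> \<beta> y (s / \<nu>) / \<nu>))) \<longlongrightarrow> 0) (at_right 0)"
  using liouville_wronskian_tendsto[of \<alpha> "1 / \<nu>" "1 / \<mu>" \<beta> y w] assms by simp

text \<open>Sturm comparison of the rescaled solutions on \<open>(0, \<nu> \<pi>/2)\<close>, the smaller of the two intervals. The
hypothesis on \<open>\<Phi>\<close> makes the coefficient of the equation increase from \<open>\<nu>\<close> to \<open>\<mu>\<close>.\<close>

lemma scaled_zeros_gap:
  fixes \<nu> \<mu> \<tau> :: real
  assumes "\<alpha> > -1" "\<beta> > -1" "\<nu> > 0" "\<nu> < \<mu>"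
    and "\<nu> - \<tau> = real n + jacobi_rho \<alpha> \<beta>" "\<mu> - \<tau> = real m + jacobi_rho \<alpha> \<beta>"
    and Phi: "\<And>x \<kappa>. 0 < x \<Longrightarrow> x < pi/2 \<Longrightarrow> \<nu> < \<kappa> \<Longrightarrow> jacobi_Phi \<alpha> \<beta> x < \<tau> * (\<kappa> - \<tau>)"
    and b: "b \<in> scaled_zeros \<alpha> \<beta> n \<nu>"
  shows "\<exists>t\<in>scaled_zeros \<alpha> \<beta> m \<mu>. t < b \<and> (\<forall>z\<in>scaled_zeros \<alpha> \<beta> n \<nu>. z < b \<longrightarrow> z < t)"
proof -
  let ?y = "jacobi_sol \<alpha> \<beta> n" and ?w = "jacobi_sol \<alpha> \<beta> m"
  have bd: "s < \<mu> * (pi/2)" if "s < \<nu> * (pi/2)" for s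
    by (rule less_trans[OF that mult_strict_right_mono[OF assms(4)]]) simp
  have \<mu>: "\<mu> > 0" using assms by simp
  have "\<exists>t. 0 < t \<and> t < b \<and> liouville \<alpha> \<beta> ?w (t / \<mu>) = 0 \<and>
      (\<forall>z. 0 < z \<and> z < b \<and> liouville \<alpha> \<beta> ?y (z / \<nu>) = 0 \<longrightarrow> z < t)"
  proof (rule sturm_comparison[where p = "\<lambda>_. 1" and r = "\<nu> * (pi/2)"
        and f = "\<lambda>s. liouville \<alpha> \<beta> ?y (s / \<nu>)" and g = "\<lambda>s. liouville \<alpha> \<beta> ?w (s / \<mu>)"
        and f' = "\<lambda>s. liouville_deriv \<alpha> \<beta> ?y (s / \<nu>) / \<nu>"
        and g' = "\<lambda>s. liouville_deriv \<alpha> \<beta> ?w (s / \<mu>) / \<mu>"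
        and qf = "\<lambda>s. scaled_potential \<alpha> \<beta> \<tau> s \<nu>" and qg = "\<lambda>s. scaled_potential \<alpha> \<beta> \<tau> s \<mu>"])
    fix t assume t: "0 < t" "t < \<nu> * (pi/2)"
    show "((\<lambda>s. liouville \<alpha> \<beta> ?y (s / \<nu>)) has_real_derivative liouville_deriv \<alpha> \<beta> ?y (t / \<nu>) / \<nu>) (at t)"
      by (rule DERIV_scaled_liouville[OF assms(3) t])
    show "((\<lambda>s. liouville \<alpha> \<beta> ?w (s / \<mu>)) has_real_derivative liouville_deriv \<alpha> \<beta> ?w (t / \<mu>) / \<mu>) (at t)"
      by (rule DERIV_scaled_liouville[OF \<mu> t(1) bd[OF t(2)]])
    show "((\<lambda>t. 1 * (liouville_deriv \<alpha> \<beta> ?y (t / \<nu>) / \<nu>)) has_real_derivative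
      - scaled_potential \<alpha> \<beta> \<tau> t \<nu> * liouville \<alpha> \<beta> ?y (t / \<nu>)) (at t)"
      by (rule DERIV_scaled_liouville_deriv[OF assms(3) t assms(1,5)])
    show "((\<lambda>t. 1 * (liouville_deriv \<alpha> \<beta> ?w (t / \<mu>) / \<mu>)) has_real_derivative
      - scaled_potential \<alpha> \<beta> \<tau> t \<mu> * liouville \<alpha> \<beta> ?w (t / \<mu>)) (at t)"
      by (rule DERIV_scaled_liouville_deriv[OF \<mu> t(1) bd[OF t(2)] assms(1,6)])
    show "scaled_potential \<alpha> \<beta> \<tau> t \<nu> < scaled_potential \<alpha> \<beta> \<tau> t \<mu>"
      by (rule scaled_potential_less[OF assms(3,4) t Phi])
  next
    show "finite {t. 0 < t \<and> t < \<nu> * (pi/2) \<and> liouville \<alpha> \<beta> ?y (t / \<nu>) = 0}"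
      using scaled_zeros_finite_card(1)[OF assms(1-3), of n] by (simp add: scaled_zeros_def)
    show "((\<lambda>s. liouville \<alpha> \<beta> ?y (s / \<nu>) * (1 * (liouville_deriv \<alpha> \<beta> ?w (s / \<mu>) / \<mu>)) -
     liouville \<alpha> \<beta> ?w (s / \<mu>) * (1 * (liouville_deriv \<alpha> \<beta> ?y (s / \<nu>) / \<nu>))) \<longlongrightarrow> 0) (at_right 0)"
      by (rule scaled_wronskian_tendsto[OF assms(1,3) \<mu>])
  qed (use b in \<open>auto simp: scaled_zeros_def\<close>)
  then show ?thesis using b bd by (fastforce simp: scaled_zeros_def)
qed

text \<open>For \<open>|\<alpha>| = |\<beta>| = 1/2\<close> the singular terms disappear, and with \<open>\<sigma> = \<rho>\<close> both rescaled solutions satisfy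
\<open>V'' + 4 V = 0\<close>. Their Wronskian is constant, hence 0, and since zeros are simple the
two functions vanish at the same points of the smaller interval.\<close>

lemma scaled_zeros_half:
  fixes \<nu> \<mu> :: real
  assumes "\<alpha> > -1" "\<beta> > -1" "\<bar>\<alpha>\<bar> = 1/2" "\<bar>\<beta>\<bar> = 1/2" "\<nu> > 0" "\<nu> < \<mu>"
    and "\<nu> = real n + jacobi_rho \<alpha> \<beta>" "\<mu> = real m + jacobi_rho \<alpha> \<beta>"
  shows "scaled_zeros \<alpha> \<beta> n \<nu> = {s \<in> scaled_zeros \<alpha> \<beta> m \<mu>. s < \<nu> * (pi/2)}"
proof -
  let ?y = "jacobi_sol \<alpha> \<beta> n" and ?w = "jacobi_sol \<alpha> \<beta> m"
  let ?r = "\<nu> * (pi/2)"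
  have bd: "s < \<mu> * (pi/2)" if "s < ?r" for s
    by (rule less_trans[OF that mult_strict_right_mono[OF assms(6)]]) simp
  have \<mu>: "\<mu> > 0" using assms by simp
  define W where "W = (\<lambda>s. liouville \<alpha> \<beta> ?y (s / \<nu>) * (1 * (liouville_deriv \<alpha> \<beta> ?w (s / \<mu>) / \<mu>)) -
     liouville \<alpha> \<beta> ?w (s / \<mu>) * (1 * (liouville_deriv \<alpha> \<beta> ?y (s / \<nu>) / \<nu>)))"
  have sq: "\<alpha>\<^sup>2 = 1/4" "\<beta>\<^sup>2 = 1/4"
    using power2_abs[of \<alpha>] power2_abs[of \<beta>] unfolding assms(3,4)
    by (simp_all add: power_divide)
  have pot: "scaled_potential \<alpha> \<beta> 0 s \<kappa> = 4" if "\<kappa> > 0" for s \<kappa>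
    using that by (simp add: scaled_potential_def liouville_potential_def sq)
  have DW: "(W has_real_derivative 0) (at s)" if s: "0 < s" "s < ?r" for s
  proof -
    have "\<nu> - 0 = real n + jacobi_rho \<alpha> \<beta>" "\<mu> - 0 = real m + jacobi_rho \<alpha> \<beta>"
      using assms(7,8) by simp_all
    from DERIV_diff[OF
      DERIV_mult[OF DERIV_scaled_liouville[OF assms(5) s]
        DERIV_scaled_liouville_deriv[OF \<mu> s(1) bd[OF s(2)] assms(1) this(2)]]
      DERIV_mult[OF DERIV_scaled_liouville[OF \<mu> s(1) bd[OF s(2)]]
        DERIV_scaled_liouville_deriv[OF assms(5) s assms(1) this(1)]]]
    show ?thesis unfolding W_def by (rule DERIV_cong) (simp add: pot assms(5) \<mu>)
  qed
  have W0: "W s = 0" if s: "0 < s" "s < ?r" for s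
  proof -
    have const: "W t = W s" if "t \<in> {0<..<?r}" for t
      by (rule DERIV_isconst3[of 0 ?r]) (use s that DW in auto)
    have "0 < ?r" using s by simp
    have "\<forall>\<^sub>F t in at_right 0. W s = W t"
      by (rule eventually_mono[OF eventually_at_right_real[OF \<open>0 < ?r\<close>]]) (rule const[symmetric])
    then have "((\<lambda>t. W t) \<longlongrightarrow> W s) (at_right 0)"
      by (rule Lim_transform_eventually[OF tendsto_const])
    moreover have "(W \<longlongrightarrow> 0) (at_right 0)"
      unfolding W_def by (rule scaled_wronskian_tendsto[OF assms(1,5) \<mu>])
    ultimately show ?thesis using tendsto_unique[OF trivial_limit_at_right_real] by blast
  qed
  have simple: "liouville_deriv \<alpha> \<beta> (jacobi_sol \<alpha> \<beta> j) (s / \<kappa>) \<noteq> 0"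
    if "\<kappa> > 0" "s \<in> scaled_zeros \<alpha> \<beta> j \<kappa>" for j s \<kappa>
  proof -
    define x where "x = s / \<kappa>"
    have x: "0 < x" "x < pi/2" and z: "liouville \<alpha> \<beta> (jacobi_sol \<alpha> \<beta> j) x = 0"
      using that by (auto simp: x_def scaled_zeros_def field_simps)
    have F: "liouville_factor \<alpha> \<beta> x \<noteq> 0"
      using sin_cos_pos[OF x] by (simp add: liouville_factor_def)
    then have p0: "poly (jacobi_sol \<alpha> \<beta> j) (cos (2 * x)) = 0" using z by (simp add: liouville_def)
    have "-1 < cos (2 * x)" "cos (2 * x) < 1"
      using x cos_monotone_0_pi[of 0 "2 * x"] cos_monotone_0_pi[of "2 * x" pi] by auto
    then have "poly (pderiv (jacobi_sol \<alpha> \<beta> j)) (cos (2 * x)) \<noteq> 0"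
      using jacobi_roots_simple[OF assms(1,2)] p0 by (simp add: jacobi_roots_def)
    moreover have "sin (2 * x) > 0" using x by (intro sin_gt_zero) auto
    ultimately show ?thesis
      using F by (simp add: liouville_deriv_def p0 x_def[symmetric])
  qed
  show ?thesis
  proof (intro set_eqI iffI)
    fix s assume s: "s \<in> scaled_zeros \<alpha> \<beta> n \<nu>"
    then have "0 < s" "s < ?r" by (auto simp: scaled_zeros_def)
    then show "s \<in> {s \<in> scaled_zeros \<alpha> \<beta> m \<mu>. s < ?r}"
      using W0[of s] simple[OF assms(5) s] s assms(5) bd[of s] by (simp add: W_def scaled_zeros_def)
  next
    fix s assume "s \<in> {s \<in> scaled_zeros \<alpha> \<beta> m \<mu>. s < ?r}"
    then have s: "s \<in> scaled_zeros \<alpha> \<beta> m \<mu>" "s < ?r" by auto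
    then have "0 < s" by (auto simp: scaled_zeros_def)
    then show "s \<in> scaled_zeros \<alpha> \<beta> n \<nu>"
      using W0[of s] simple[OF \<mu> s(1)] s \<mu> by (simp add: W_def scaled_zeros_def)
  qed
qed

theorem theorem2p2:
  fixes \<alpha> \<beta> :: real
  assumes "\<alpha> > -1" and "\<beta> > -1" and "\<bar>\<beta>\<bar> \<ge> 1/2"
  shows "bdd_above (jacobi_Phi \<alpha> \<beta> ` {0<..<pi/2}) \<and>
    (\<forall>\<sigma>::real. \<sigma> \<ge> sigma_down \<alpha> \<beta> \<longrightarrow>
      (\<forall>n\<ge>1. \<forall>k\<in>{1..n}.
         (real n + 1 + \<sigma>) * jacobi_angle \<alpha> \<beta> (n + 1) k
           \<le> (real n + \<sigma>) * jacobi_angle \<alpha> \<beta> n k) \<and>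
      ((\<exists>n\<ge>1. \<exists>k\<in>{1..n}.
         (real n + 1 + \<sigma>) * jacobi_angle \<alpha> \<beta> (n + 1) k
           = (real n + \<sigma>) * jacobi_angle \<alpha> \<beta> n k)
        \<longleftrightarrow> \<bar>\<alpha>\<bar> = 1/2 \<and> \<bar>\<beta>\<bar> = 1/2 \<and> \<sigma> = jacobi_rho \<alpha> \<beta>) \<and>
      (\<bar>\<alpha>\<bar> = 1/2 \<and> \<bar>\<beta>\<bar> = 1/2 \<and> \<sigma> = jacobi_rho \<alpha> \<beta> \<longrightarrow>
        (\<forall>n\<ge>1. \<forall>k\<in>{1..n}.
          (real n + 1 + \<sigma>) * jacobi_angle \<alpha> \<beta> (n + 1) k
            = (real n + \<sigma>) * jacobi_angle \<alpha> \<beta> n k)))"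
proof -
  let ?\<rho> = "jacobi_rho \<alpha> \<beta>" and ?M = "jacobi_M \<alpha> \<beta>"
  have \<rho>: "?\<rho> > -1/2" using assms by (simp add: jacobi_rho_def)
  let ?exceptional = "\<lambda>\<sigma>. \<bar>\<alpha>\<bar> = 1/2 \<and> \<bar>\<beta>\<bar> = 1/2 \<and> \<sigma> = ?\<rho>"
  have pos: "real n + \<sigma> > 0" if "\<sigma> \<ge> ?\<rho>" "n \<ge> 1" for n \<sigma>
    using that \<rho> by linarith
  have ge_rho: "\<sigma> \<ge> ?\<rho>" if "\<sigma> \<ge> sigma_down \<alpha> \<beta>" for \<sigma>
  proof -
    have "max ?M 0 / (1 + ?\<rho>) \<ge> 0" using \<rho> by (intro divide_nonneg_nonneg) auto
    then show ?thesis using that by (simp add: sigma_down_def)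
  qed
  have strict: "(real n + 1 + \<sigma>) * jacobi_angle \<alpha> \<beta> (n + 1) k < (real n + \<sigma>) * jacobi_angle \<alpha> \<beta> n k"
    if \<sigma>: "\<sigma> \<ge> sigma_down \<alpha> \<beta>" and nk: "n \<ge> 1" "k \<in> {1..n}" and ne: "\<not> ?exceptional \<sigma>" for \<sigma> n k
  proof -
    define \<nu> \<mu> \<tau> where "\<nu> = real n + \<sigma>" and "\<mu> = real n + 1 + \<sigma>" and "\<tau> = \<sigma> - ?\<rho>"
    have \<tau>0: "\<tau> \<ge> 0" using ge_rho[OF \<sigma>] by (simp add: \<tau>_def)
    have \<nu>: "\<nu> > 0" "\<nu> < \<mu>" using pos[OF ge_rho[OF \<sigma>] nk(1)] by (auto simp: \<nu>_def \<mu>_def)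
    have "max ?M 0 / (1 + ?\<rho>) \<le> \<tau>" using \<sigma> by (simp add: sigma_down_def \<tau>_def)
    then have \<tau>: "max ?M 0 \<le> \<tau> * (1 + ?\<rho>)" using \<rho> by (simp add: pos_divide_le_eq)
    \<comment> \<open>From \<open>\<kappa> > n + \<sigma>\<close> follows \<open>\<kappa> - \<tau> > n + \<rho> \<ge> 1 + \<rho>\<close>; its strictness excludes equality when \<open>\<tau> > 0\<close>.\<close>
    have Phi: "jacobi_Phi \<alpha> \<beta> x < \<tau> * (\<kappa> - \<tau>)" if x: "0 < x" "x < pi/2" and \<kappa>: "\<nu> < \<kappa>" for x \<kappa>
    proof (cases "\<tau> = 0")
      case True
      then have "?M \<le> 0" "\<bar>\<alpha>\<bar> \<noteq> 1/2 \<or> \<bar>\<beta>\<bar> \<noteq> 1/2" using \<tau> ne by (auto simp: \<tau>_def)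
      from jacobi_Phi_neg[OF assms(3) this x] show ?thesis using True by simp
    next
      case False
      have "jacobi_Phi \<alpha> \<beta> x \<le> \<tau> * (1 + ?\<rho>)"
        using jacobi_Phi_le_M[OF assms(3) x, of \<alpha>] \<tau> by simp
      also have "\<dots> < \<tau> * (\<kappa> - \<tau>)"
        using False \<tau>0 \<kappa> nk(1) by (intro mult_strict_left_mono) (auto simp: \<nu>_def \<tau>_def)
      finally show ?thesis .
    qed
    let ?F = "scaled_zeros \<alpha> \<beta> n \<nu>" and ?G = "scaled_zeros \<alpha> \<beta> (n + 1) \<mu>"
    have \<mu>0: "\<mu> > 0" using \<nu> by simp
    have "sorted_list_of_set ?G ! (k - 1) < sorted_list_of_set ?F ! (k - 1)"
    proof (rule sorted_list_of_set_gap(2))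
      fix b assume "b \<in> ?F"
      then show "\<exists>t\<in>?G. t < b \<and> (\<forall>z\<in>?F. z < b \<longrightarrow> z < t)"
        by (intro scaled_zeros_gap[OF assms(1,2) \<nu>, where \<tau> = \<tau>] Phi)
           (auto simp: \<nu>_def \<mu>_def \<tau>_def)
    next
      show "finite ?F" "finite ?G"
        using scaled_zeros_finite_card(1)[OF assms(1,2)] \<nu> \<mu>0 by auto
      show "k - 1 < card ?F"
        using scaled_zeros_finite_card(2)[OF assms(1,2) \<nu>(1)] nk by auto
    qed
    then have "\<mu> / 2 * jacobi_angle \<alpha> \<beta> (n + 1) k < \<nu> / 2 * jacobi_angle \<alpha> \<beta> n k"
      using scaled_zeros_nth[OF assms(1,2), of \<nu> k n] scaled_zeros_nth[OF assms(1,2), of \<mu> k "n + 1"]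
        nk \<nu> \<mu>0 by auto
    then show ?thesis by (simp add: \<nu>_def \<mu>_def)
  qed
  have equal: "(real n + 1 + \<sigma>) * jacobi_angle \<alpha> \<beta> (n + 1) k = (real n + \<sigma>) * jacobi_angle \<alpha> \<beta> n k"
    if nk: "n \<ge> 1" "k \<in> {1..n}" and ex: "?exceptional \<sigma>" for \<sigma> n k
  proof -
    define \<nu> \<mu> where "\<nu> = real n + \<sigma>" and "\<mu> = real n + 1 + \<sigma>"
    have \<nu>: "\<nu> > 0" "\<nu> < \<mu>" "\<mu> > 0" using pos[of \<sigma> n] nk(1) ex by (auto simp: \<nu>_def \<mu>_def)
    let ?F = "scaled_zeros \<alpha> \<beta> n \<nu>" and ?G = "scaled_zeros \<alpha> \<beta> (n + 1) \<mu>"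
    have F: "?F = {s \<in> ?G. s < \<nu> * (pi/2)}"
      by (rule scaled_zeros_half[OF assms(1,2)]) (use ex \<nu> in \<open>auto simp: \<nu>_def \<mu>_def\<close>)
    have "sorted_list_of_set ?F ! (k - 1) = sorted_list_of_set ?G ! (k - 1)"
      unfolding F
    proof (rule sorted_list_of_set_initial)
      show "finite ?G" using scaled_zeros_finite_card(1)[OF assms(1,2)] \<nu> by auto
      show "k - 1 < card {s \<in> ?G. s < \<nu> * (pi/2)}"
        unfolding F[symmetric] using scaled_zeros_finite_card(2)[OF assms(1,2) \<nu>(1)] nk by auto
    qed
    then have "\<nu> / 2 * jacobi_angle \<alpha> \<beta> n k = \<mu> / 2 * jacobi_angle \<alpha> \<beta> (n + 1) k"
      using scaled_zeros_nth[OF assms(1,2), of \<nu> k n] scaled_zeros_nth[OF assms(1,2), of \<mu> k "n + 1"]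
        nk \<nu> by auto
    then show ?thesis by (simp add: \<nu>_def \<mu>_def)
  qed
  have eq_iff: "(\<exists>n\<ge>1. \<exists>k\<in>{1..n}.
      (real n + 1 + \<sigma>) * jacobi_angle \<alpha> \<beta> (n + 1) k = (real n + \<sigma>) * jacobi_angle \<alpha> \<beta> n k)
      \<longleftrightarrow> ?exceptional \<sigma>" if \<sigma>: "\<sigma> \<ge> sigma_down \<alpha> \<beta>" for \<sigma>
  proof
    assume "?exceptional \<sigma>"
    then show "\<exists>n\<ge>1. \<exists>k\<in>{1..n}.
      (real n + 1 + \<sigma>) * jacobi_angle \<alpha> \<beta> (n + 1) k = (real n + \<sigma>) * jacobi_angle \<alpha> \<beta> n k"
      using equal[of 1 1 \<sigma>] by (intro exI[of _ 1]) auto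
  qed (use strict[OF \<sigma>] in force)
  have le: "(real n + 1 + \<sigma>) * jacobi_angle \<alpha> \<beta> (n + 1) k \<le> (real n + \<sigma>) * jacobi_angle \<alpha> \<beta> n k"
    if "\<sigma> \<ge> sigma_down \<alpha> \<beta>" "n \<ge> 1" "k \<in> {1..n}" for \<sigma> n k
    using strict[OF that] equal[OF that(2,3)] by (cases "?exceptional \<sigma>") (simp, force)
  show ?thesis
    by (intro conjI allI impI ballI bdd_above_jacobi_Phi[OF assms(3)] le eq_iff equal) simp_all
qed

end
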